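(* Let $n\in\mathbb{N}$, $k\in\{1,\ldots,n\}$ and $p\in[1,\infty)$. Let $X$ be a random vector uniformly distributed in $\mathbb{B}_p^n=\{x\in\mathbb{R}^n:\|x\|_p\le1\}$ and let $E$ be a random $k$-dimensional linear subspace of $\mathbb{R}^n$, independent of $X$ and distributed according to the Haar probability measure $\nu_{n,k}$ on the Grassmannian $\mathbb{G}_{n,k}$. Let $U$ be uniformly distributed on $[0,1]$, let $Z_1,\ldots,Z_n$ be $p$-generalized Gaussian random variables, and let $g_1,\ldots,g_n$ be standard Gaussian random variables, with $U,Z_1,\ldots,Z_n,g_1,\ldots,g_n$ all independent. Then the random variable $\|P_EX\|_2$, where $P_E$ is the orthogonal projection onto $E$, has the same distribution as the random variable $$ U^{1/n}\,\frac{\big(\sum_{i=1}^n Z_i^2\big)^{1/2}}{\big(\sum_{i=1}^n |Z_i|^p\big)^{1/p}}\,\frac{\big(\sum_{i=1}^k g_i^2\big)^{1/2}}{\big(\sum_{i=1}^n g_i^2\big)^{1/2}}. $$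
   Context: For $p\in[1,\infty)$, $\|x\|_p=(\sum_i|x_i|^p)^{1/p}$. A $p$-generalized Gaussian random variable is a real random variable with density $f_p(x)=\frac{1}{2p^{1/p}\Gamma(1+1/p)}e^{-|x|^p/p}$, $x\in\mathbb{R}$, with respect to Lebesgue measure. The Haar probability measure $\nu_{n,k}$ on the Grassmannian $\mathbb{G}_{n,k}$ of $k$-dimensional linear subspaces of $\mathbb{R}^n$ is the image of the Haar probability measure on $\mathcal{SO}(n)$ (special orthogonal group) under $T\mapsto T\,\mathrm{span}(\{e_1,\ldots,e_k\})$, with $e_1,\dots,e_n$ the standard basis. *)

theory Defs
  imports "HOL-Probability.Probability"
begin

definition lp_norm :: "real \<Rightarrow> real ^ 'n \<Rightarrow> real" where
  "lp_norm p x = (\<Sum>i\<in>UNIV. \<bar>x $ i\<bar> powr p) powr (1 / p)"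

definition lp_ball :: "real \<Rightarrow> (real ^ 'n) set" where
  "lp_ball p = {x. lp_norm p x \<le> 1}"

definition p_gaussian_density :: "real \<Rightarrow> real \<Rightarrow> real" where
  "p_gaussian_density p x =
     1 / (2 * p powr (1 / p) * Gamma (1 + 1 / p)) * exp (- (\<bar>x\<bar> powr p) / p)"

definition orth_proj :: "(real ^ 'n) set \<Rightarrow> real ^ 'n \<Rightarrow> real ^ 'n" where
  "orth_proj V x = (THE y. y \<in> V \<and> (\<forall>z\<in>V. orthogonal (x - y) z))"

definition SO :: "(real ^ 'n ^ 'n) set" where
  "SO = {T. rotation_matrix T}"

(* A left-invariant Borel probability measure on the compact group SO(n); it exists, is unique,
   and is automatically regular and right-invariant. *)
definition haar_prob_SO :: "(real ^ 'n ^ 'n) measure \<Rightarrow> bool" where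
  "haar_prob_SO \<mu> \<longleftrightarrow>
     prob_space \<mu> \<and> sets \<mu> = sets (restrict_space borel SO) \<and>
     (\<forall>S\<in>SO. distr \<mu> \<mu> (\<lambda>T. S ** T) = \<mu>)"

definition grassmannian :: "nat \<Rightarrow> (real ^ 'n) set set" where
  "grassmannian k = {V. subspace V \<and> dim V = k}"

(* The coordinates of real ^ 'n carry no order, so the standard basis e_1, ..., e_n is numbered
   by an enumeration idx of the index type: e_i = axis (idx i) 1. *)
definition std_subspace :: "(nat \<Rightarrow> 'n) \<Rightarrow> nat \<Rightarrow> (real ^ 'n) set" where
  "std_subspace idx k = span ((\<lambda>i. axis (idx i) 1) ` {1..k})"

definition rotated_subspace :: "(nat \<Rightarrow> 'n) \<Rightarrow> nat \<Rightarrow> real ^ 'n ^ 'n \<Rightarrow> (real ^ 'n) set" where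
  "rotated_subspace idx k T = (\<lambda>x. T *v x) ` std_subspace idx k"

(* Borel sigma-algebra of the usual topology of the Grassmannian, i.e. the quotient topology
   induced by T \<mapsto> T span(e_1, ..., e_k) from SO(n); it does not depend on idx. *)
definition grassmannian_borel :: "(nat \<Rightarrow> 'n) \<Rightarrow> nat \<Rightarrow> (real ^ 'n) set measure" where
  "grassmannian_borel idx k =
     sigma (grassmannian k)
       {W. W \<subseteq> grassmannian k \<and>
           openin (top_of_set SO) {T \<in> SO. rotated_subspace idx k T \<in> W}}"

definition grassmannian_haar ::
  "(real ^ 'n ^ 'n) measure \<Rightarrow> (nat \<Rightarrow> 'n) \<Rightarrow> nat \<Rightarrow> (real ^ 'n) set measure" where
  "grassmannian_haar \<mu> idx k = distr \<mu> (grassmannian_borel idx k) (rotated_subspace idx k)"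

(* Independence of two random variables with values in measurable spaces over different types;
   the library's indep_var requires both to have the same value type. *)
definition indep_rvs ::
  "'a measure \<Rightarrow> 'b measure \<Rightarrow> ('a \<Rightarrow> 'b) \<Rightarrow> 'c measure \<Rightarrow> ('a \<Rightarrow> 'c) \<Rightarrow> bool" where
  "indep_rvs M S X T Y \<longleftrightarrow>
     X \<in> measurable M S \<and> Y \<in> measurable M T \<and>
     prob_space.indep_set M {X -` A \<inter> space M | A. A \<in> sets S} {Y -` B \<inter> space M | B. B \<in> sets T}"

end

theory Submission
  imports Defs
begin

text \<open>
  The length of the projection splits into two independent factors, the length of \<open>X\<close> and the cosine
  of the angle between \<open>X\<close> and the random subspace \<open>E\<close>, and each factor is identified separately.

  For the angle, write \<open>E\<close> as the image of the span of the first \<open>k\<close> basis vectors under a Haar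
  distributed rotation \<open>T\<close>. Then the projection of \<open>x\<close> onto \<open>E\<close> is as long as the vector of the first
  \<open>k\<close> coordinates of \<open>T\<^sup>t x\<close>. By left invariance the law of this length depends on \<open>x\<close> only through its norm; averaging
  over a Gaussian direction, whose law is itself invariant under rotations, removes \<open>T\<close> and gives \<open>norm x\<close> times the
  ratio of the norm of the first \<open>k\<close> coordinates of a Gaussian vector to the norm of the whole vector
  (\<open>distr_haar_homogeneous\<close>). Integrating over \<open>X\<close>, which is independent of \<open>E\<close>, gives the
  product form \<open>distr_norm_orth_proj\<close>.

  For the length, the vector \<open>Z\<close> has a density that depends only on its \<open>p\<close>-norm. Homogeneity alone then shows
  that a uniform point of the \<open>p\<close>-ball has the Euclidean length of \<open>U powr (1/n) *\<^sub>R Z /\<^sub>R lp_norm p Z\<close>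
  (\<open>distr_gauge_uniform_ball\<close>): the intersection of the \<open>p\<close>-ball with a Euclidean ball is
  the unit ball of another gauge, and \<open>volume_gauge_ball\<close> expresses its volume as a moment
  of \<open>Z\<close>.
\<close>

section \<open>Lebesgue measure in coordinates\<close>

lemma borel_measurable_vec_lambda:
  fixes f :: "'n::finite \<Rightarrow> 'a \<Rightarrow> real"
  assumes "\<And>j. f j \<in> borel_measurable M"
  shows "(\<lambda>\<omega>. \<chi> j. f j \<omega>) \<in> borel_measurable M"
  using assms by (subst borel_measurable_euclidean_space) (auto simp: Basis_vec_def inner_axis)

text \<open>
  This identity lets Tonelli's theorem and independence, both stated for product measures, act on
  measures on \<^typ>\<open>real ^ 'n\<close>.
\<close>

lemma lborel_vec_eq_PiM:
  "(lborel :: (real ^ 'n) measure) = distr (\<Pi>\<^sub>M j\<in>UNIV. lborel) borel (\<lambda>f. \<chi> j. f j)"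
proof (rule lborel_eqI)
  interpret product_sigma_finite "\<lambda>_::'n. lborel :: real measure" ..
  have meas: "(\<lambda>f. \<chi> j. f j) \<in> measurable (\<Pi>\<^sub>M j\<in>(UNIV::'n set). lborel) (borel :: (real ^ 'n) measure)"
    by (rule borel_measurable_vec_lambda) simp
  fix l u :: "real ^ 'n"
  assume le: "\<And>b. b \<in> Basis \<Longrightarrow> l \<bullet> b \<le> u \<bullet> b"
  then have le': "l $ j \<le> u $ j" for j
    using le[of "axis j 1"] by (simp add: inner_axis)
  have "(\<lambda>f. \<chi> j. f j) -` box l u \<inter> space (\<Pi>\<^sub>M j\<in>(UNIV::'n set). (lborel :: real measure))
      = Pi\<^sub>E UNIV (\<lambda>j. box (l $ j) (u $ j))"
    by (auto simp: space_PiM box_def Basis_vec_def inner_axis PiE_iff)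
  then have "emeasure (distr (\<Pi>\<^sub>M j\<in>(UNIV::'n set). lborel) borel (\<lambda>f. \<chi> j. f j)) (box l u)
      = (\<Prod>j\<in>UNIV. emeasure lborel (box (l $ j) (u $ j)))"
    by (simp add: emeasure_distr[OF meas] emeasure_PiM)
  also have "\<dots> = ennreal (\<Prod>j\<in>UNIV. (u - l) $ j)"
    using le' by (subst prod_ennreal[symmetric]) (auto intro!: prod.cong)
  also have "(\<Prod>j\<in>UNIV. (u - l) $ j) = (\<Prod>b\<in>Basis. (u - l) \<bullet> b)"
    by (rule prod.reindex_bij_witness[of _ "\<lambda>b. SOME j. b = axis j 1" "\<lambda>j. axis j 1"])
      (auto simp: Basis_vec_def inner_axis axis_eq_axis)
  finally show "emeasure (distr (\<Pi>\<^sub>M j\<in>(UNIV::'n set). lborel) borel (\<lambda>f. \<chi> j. f j)) (box l u)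
      = (\<Prod>b\<in>Basis. (u - l) \<bullet> b)" .
qed simp

lemma (in prob_space) distr_indep_coordinates:
  fixes Y :: "'n::finite \<Rightarrow> 'a \<Rightarrow> real" and f :: "real \<Rightarrow> real"
  assumes f: "f \<in> borel_measurable borel" "\<And>t. 0 \<le> f t"
    and Y: "\<And>j. distributed M lborel (Y j) f"
    and indep: "indep_vars (\<lambda>_. borel) Y UNIV"
  shows "distr M borel (\<lambda>\<omega>. \<chi> j. Y j \<omega>) = density lborel (\<lambda>x. ennreal (\<Prod>j\<in>UNIV. f (x $ j)))"
proof -
  let ?D = "density lborel (\<lambda>t. ennreal (f t))"
  have distrY: "distr M borel (Y j) = ?D" for j
    using distributed_distr_eq_density[OF Y] by (metis distr_cong sets_lborel)
  have Ym: "Y j \<in> borel_measurable M" for j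
    using distributed_measurable[OF Y] by simp
  have probD: "prob_space ?D"
    using prob_space_distr[OF Ym] distrY by simp
  interpret L: product_sigma_finite "\<lambda>_::'n. lborel :: real measure" ..
  interpret D: product_sigma_finite "\<lambda>_::'n. ?D"
    by (simp add: product_sigma_finite_def probD prob_space_imp_sigma_finite)
  have vec: "(\<lambda>f. \<chi> j. f j) \<in> measurable (\<Pi>\<^sub>M j\<in>(UNIV::'n set). borel) (borel :: (real ^ 'n) measure)"
    by (rule borel_measurable_vec_lambda) simp
  have vecL: "(\<lambda>f. \<chi> j. f j) \<in> measurable (\<Pi>\<^sub>M j\<in>(UNIV::'n set). lborel) (borel :: (real ^ 'n) measure)"
    using vec by (simp cong: measurable_cong_sets sets_PiM_cong)
  have "distr M (\<Pi>\<^sub>M j\<in>UNIV. borel) (\<lambda>\<omega>. \<lambda>j\<in>UNIV. Y j \<omega>) = (\<Pi>\<^sub>M j\<in>UNIV. distr M borel (Y j))"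
    using indep Ym by (subst (asm) indep_vars_iff_distr_eq_PiM') auto
  also have "\<dots> = (\<Pi>\<^sub>M j\<in>UNIV. ?D)"
    by (simp add: distrY)
  also have "\<dots> = density (\<Pi>\<^sub>M j\<in>UNIV. lborel) (\<lambda>x. \<Prod>j\<in>UNIV. ennreal (f (x j)))"
  proof (rule D.PiM_eqI[symmetric])
    show "sets (density (\<Pi>\<^sub>M j\<in>UNIV. lborel) (\<lambda>x. \<Prod>j\<in>UNIV. ennreal (f (x j)))) = sets (\<Pi>\<^sub>M j\<in>(UNIV::'n set). ?D)"
      by (simp cong: sets_PiM_cong)
    fix A :: "'n \<Rightarrow> real set"
    assume "\<And>i. i \<in> UNIV \<Longrightarrow> A i \<in> sets ?D"
    then have A[measurable]: "A i \<in> sets borel" for i by simp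
    have "emeasure (density (\<Pi>\<^sub>M j\<in>UNIV. lborel) (\<lambda>x. \<Prod>j\<in>UNIV. ennreal (f (x j)))) (Pi\<^sub>E UNIV A)
        = (\<integral>\<^sup>+x. (\<Prod>j\<in>UNIV. ennreal (f (x j))) * indicator (Pi\<^sub>E UNIV A) x \<partial>(\<Pi>\<^sub>M j\<in>UNIV. lborel))"
      using f by (subst emeasure_density) (auto intro!: sets_PiM_I_finite)
    also have "\<dots> = (\<integral>\<^sup>+x. (\<Prod>j\<in>UNIV. ennreal (f (x j)) * indicator (A j) (x j)) \<partial>(\<Pi>\<^sub>M j\<in>UNIV. lborel))"
      by (auto intro!: nn_integral_cong simp: prod.distrib indicator_def PiE_iff Pi_iff)
    also have "\<dots> = (\<Prod>j\<in>UNIV. \<integral>\<^sup>+t. ennreal (f t) * indicator (A j) t \<partial>lborel)"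
      using f by (intro L.product_nn_integral_prod) auto
    also have "\<dots> = (\<Prod>j\<in>UNIV. emeasure ?D (A j))"
      using f by (simp add: emeasure_density)
    finally show "emeasure (density (\<Pi>\<^sub>M j\<in>UNIV. lborel) (\<lambda>x. \<Prod>j\<in>UNIV. ennreal (f (x j)))) (Pi\<^sub>E UNIV A)
        = (\<Prod>j\<in>UNIV. emeasure ?D (A j))" .
  qed simp
  finally have eq: "distr M (\<Pi>\<^sub>M j\<in>UNIV. borel) (\<lambda>\<omega>. \<lambda>j\<in>UNIV. Y j \<omega>)
      = density (\<Pi>\<^sub>M j\<in>UNIV. lborel) (\<lambda>x. \<Prod>j\<in>UNIV. ennreal (f (x j)))" .
  have "distr M borel (\<lambda>\<omega>. \<chi> j. Y j \<omega>)
      = distr (distr M (\<Pi>\<^sub>M j\<in>UNIV. borel) (\<lambda>\<omega>. \<lambda>j\<in>UNIV. Y j \<omega>)) borel (\<lambda>f. \<chi> j. f j)"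
    using vec Ym by (subst distr_distr) (auto simp: comp_def restrict_UNIV intro!: measurable_PiM_single')
  also have "\<dots> = density (distr (\<Pi>\<^sub>M j\<in>UNIV. lborel) borel (\<lambda>f. \<chi> j. f j)) (\<lambda>x. \<Prod>j\<in>UNIV. ennreal (f (x $ j)))"
    unfolding eq using f vecL by (subst density_distr) auto
  also have "\<dots> = density lborel (\<lambda>x. ennreal (\<Prod>j\<in>UNIV. f (x $ j)))"
    using f by (simp add: lborel_vec_eq_PiM[symmetric] prod_ennreal)
  finally show ?thesis .
qed

lemma nn_integral_lborel_scaleR:
  fixes f :: "'a::euclidean_space \<Rightarrow> ennreal"
  assumes f[measurable]: "f \<in> borel_measurable borel" and s: "0 < s"
  shows "(\<integral>\<^sup>+x. f x \<partial>lborel) = ennreal (s ^ DIM('a)) * (\<integral>\<^sup>+x. f (s *\<^sub>R x) \<partial>lborel)"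
  using s by (subst lborel_affine[of s 0])
    (auto simp: nn_integral_density nn_integral_distr nn_integral_cmult)

text \<open>
  The image \<open>\<nu>\<close> of Lebesgue measure \<open>\<lambda>\<close> is again translation invariant, because the transformation is linear
  and onto. Translation-invariant measures are proportional: for a Borel set \<open>A\<close> the double integral of
  \<open>1\<^sub>A(x) 1\<^sub>B(x + y)\<close> over \<open>\<nu> \<Otimes> \<lambda>\<close> equals \<open>\<nu>(A) \<lambda>(B)\<close> by a shift in \<open>y\<close>, and \<open>\<lambda>(A) \<nu>(B)\<close> by a shift
  in \<open>x\<close> and a reflection in \<open>y\<close>. Taking for \<open>A\<close> the unit ball, which is mapped onto itself, shows that the
  proportionality factor is 1.
\<close>

lemma lborel_distr_orthogonal_transformation:
  fixes f :: "'a::euclidean_space \<Rightarrow> 'a"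
  assumes f: "orthogonal_transformation f"
  shows "distr lborel borel f = lborel"
proof -
  define \<nu> where "\<nu> = distr lborel borel f"
  have lin: "linear f" using f by (rule orthogonal_transformation_linear)
  have f_meas[measurable]: "f \<in> borel_measurable borel"
    using lin by (intro borel_measurable_continuous_onI linear_continuous_on) (simp add: linear_linear)
  have sets_\<nu>[measurable_cong]: "sets \<nu> = sets borel" and sp: "space \<nu> = UNIV" by (simp_all add: \<nu>_def)
  have ball: "f -` ball (0::'a) r = ball (0::'a) r" for r
    using f by (auto simp: orthogonal_transformation)
  have surj: "surj f" using f by (rule orthogonal_transformation_surj)
  have \<nu>_ball: "emeasure \<nu> (ball 0 r) = emeasure lborel (ball (0::'a) r)" for r
    by (simp add: \<nu>_def emeasure_distr ball)
  interpret \<nu>: sigma_finite_measure \<nu>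
  proof
    show "\<exists>A. countable A \<and> A \<subseteq> sets \<nu> \<and> \<Union> A = space \<nu> \<and> (\<forall>a\<in>A. emeasure \<nu> a \<noteq> \<infinity>)"
    proof (intro exI[of _ "range (\<lambda>n::nat. ball 0 (real n))"] conjI ballI)
      show "\<Union> (range (\<lambda>n::nat. ball (0::'a) (real n))) = space \<nu>"
        by (auto simp: sp intro: reals_Archimedean2)
    qed (auto simp: sets_\<nu> \<nu>_ball less_top emeasure_lborel_ball_finite[unfolded infinity_ennreal_def])
  qed
  interpret P: pair_sigma_finite lborel \<nu> ..
  have trans_lborel: "(\<integral>\<^sup>+y. h (x + y) \<partial>lborel) = (\<integral>\<^sup>+y. h y \<partial>lborel)"
    if [measurable]: "h \<in> borel_measurable borel" for h :: "'a \<Rightarrow> ennreal" and x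
    by (subst (2) lborel_distr_plus[of x, symmetric]) (simp add: nn_integral_distr)
  have refl_lborel: "(\<integral>\<^sup>+y. h (- y) \<partial>lborel) = (\<integral>\<^sup>+y. h y \<partial>lborel)"
    if [measurable]: "h \<in> borel_measurable borel" for h :: "'a \<Rightarrow> ennreal"
    by (subst (2) lborel_affine[of "-1" 0]) (simp_all add: nn_integral_density nn_integral_distr)
  have trans_\<nu>: "(\<integral>\<^sup>+x. h (x - y) \<partial>\<nu>) = (\<integral>\<^sup>+x. h x \<partial>\<nu>)"
    if [measurable]: "h \<in> borel_measurable borel" for h :: "'a \<Rightarrow> ennreal" and y
  proof -
    obtain z where z: "- y = f z" using surj by (metis surjD)
    have "(\<integral>\<^sup>+x. h (x - y) \<partial>\<nu>) = (\<integral>\<^sup>+x. h (f (z + x)) \<partial>lborel)"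
      unfolding \<nu>_def by (subst nn_integral_distr) (auto simp: linear_add[OF lin] z[symmetric])
    also have "\<dots> = (\<integral>\<^sup>+x. h (f x) \<partial>lborel)"
      by (rule trans_lborel) simp
    finally show ?thesis by (simp add: \<nu>_def nn_integral_distr)
  qed
  have "lborel = \<nu>"
  proof (rule measure_eqI)
    fix B :: "'a set" assume "B \<in> sets lborel"
    then have B[measurable]: "B \<in> sets borel" by simp
    \<comment> \<open>The unit ball has the same positive finite mass under both measures, so it cancels at the end.\<close>
    define A where "A = ball (0::'a) 1"
    have A[measurable]: "A \<in> sets borel" by (simp add: A_def)
    have "emeasure \<nu> A * emeasure lborel B = (\<integral>\<^sup>+x. \<integral>\<^sup>+y. indicator A x * indicator B y \<partial>lborel \<partial>\<nu>)"
      by (simp add: nn_integral_cmult nn_integral_multc)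
    also have "\<dots> = (\<integral>\<^sup>+x. \<integral>\<^sup>+y. indicator A x * indicator B (x + y) \<partial>lborel \<partial>\<nu>)"
    proof (rule nn_integral_cong)
      fix x
      show "(\<integral>\<^sup>+y. indicator A x * indicator B y \<partial>lborel) = (\<integral>\<^sup>+y. indicator A x * indicator B (x + y) \<partial>lborel)"
        by (rule trans_lborel[of "\<lambda>y. indicator A x * indicator B y", symmetric]) simp
    qed
    also have "\<dots> = (\<integral>\<^sup>+y. \<integral>\<^sup>+x. indicator A x * indicator B (x + y) \<partial>\<nu> \<partial>lborel)"
      by (rule P.Fubini') measurable
    also have "\<dots> = (\<integral>\<^sup>+y. \<integral>\<^sup>+x. indicator A (x - y) * indicator B x \<partial>\<nu> \<partial>lborel)"
    proof (rule nn_integral_cong)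
      fix y
      show "(\<integral>\<^sup>+x. indicator A x * indicator B (x + y) \<partial>\<nu>) = (\<integral>\<^sup>+x. indicator A (x - y) * indicator B x \<partial>\<nu>)"
        using trans_\<nu>[of "\<lambda>x. indicator A x * indicator B (x + y)" y] by simp
    qed
    also have "\<dots> = (\<integral>\<^sup>+x. \<integral>\<^sup>+y. indicator A (x - y) * indicator B x \<partial>lborel \<partial>\<nu>)"
      by (rule P.Fubini'[symmetric]) measurable
    also have "\<dots> = (\<integral>\<^sup>+x. emeasure lborel A * indicator B x \<partial>\<nu>)"
    proof (rule nn_integral_cong)
      fix x
      have "(\<integral>\<^sup>+y. indicator A (x - y) * indicator B x \<partial>lborel)
          = (\<integral>\<^sup>+y. indicator A (x + y) \<partial>lborel) * indicator B x"
        by (subst refl_lborel[symmetric]) (auto simp: nn_integral_multc)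
      also have "\<dots> = emeasure lborel A * indicator B x"
        by (subst trans_lborel) auto
      finally show "(\<integral>\<^sup>+y. indicator A (x - y) * indicator B x \<partial>lborel) = emeasure lborel A * indicator B x" .
    qed
    also have "\<dots> = emeasure lborel A * emeasure \<nu> B"
      by (simp add: nn_integral_cmult)
    finally have "emeasure lborel A * emeasure lborel B = emeasure lborel A * emeasure \<nu> B"
      by (simp add: \<nu>_ball A_def)
    moreover have "emeasure lborel A \<noteq> 0"
      using content_ball_pos[of 1 "0::'a"] by (auto simp: A_def measure_def)
    moreover have "emeasure lborel A \<noteq> top"
      using emeasure_lborel_ball_finite[of "0::'a" 1] by (simp add: A_def less_top)
    ultimately show "emeasure lborel B = emeasure \<nu> B"
      by (simp add: ennreal_mult_cancel_left)
  qed (simp add: sets_\<nu>)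
  then show ?thesis by (simp add: \<nu>_def)
qed

section \<open>Volumes of gauge balls\<close>

text \<open>
  The Minkowski functional of a body that is star-shaped about the origin. The class is closed under
  maxima, that is, under intersecting the bodies; \<open>max (\<rho> x) (\<tau> x / a)\<close> is the case that matters below.
\<close>

definition gauge_function :: "('a::real_vector \<Rightarrow> real) \<Rightarrow> bool" where
  "gauge_function \<psi> \<longleftrightarrow> (\<forall>x. x \<noteq> 0 \<longrightarrow> 0 < \<psi> x) \<and> (\<forall>s>0. \<forall>x. \<psi> (s *\<^sub>R x) = s * \<psi> x)"

lemma gauge_function_pos: "gauge_function \<psi> \<Longrightarrow> x \<noteq> 0 \<Longrightarrow> 0 < \<psi> x"
  and gauge_function_scaleR: "gauge_function \<psi> \<Longrightarrow> 0 < s \<Longrightarrow> \<psi> (s *\<^sub>R x) = s * \<psi> x"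
  by (auto simp: gauge_function_def)

lemma nn_integral_power_tail:
  fixes a :: real
  assumes "0 < a" "0 < n"
  shows "(\<integral>\<^sup>+s. ennreal (real n / s ^ (n + 1)) * indicator {a..} s \<partial>lborel) = ennreal (1 / a ^ n)"
proof -
  have "(\<integral>\<^sup>+s. ennreal (real n / s ^ (n + 1)) * indicator {a..} s \<partial>lborel) = ennreal (0 - (- (1 / a ^ n)))"
  proof (rule nn_integral_FTC_atLeast)
    fix s assume s: "a \<le> s"
    then have "s > 0" using assms by simp
    have n: "s ^ n = s * s ^ (n - Suc 0)" using assms(2) by (cases n) auto
    show "((\<lambda>s. - (1 / s ^ n)) has_real_derivative real n / s ^ (n + 1)) (at s)"
      using \<open>s > 0\<close> n by (auto intro!: derivative_eq_intros simp: field_simps)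
    show "0 \<le> real n / s ^ (n + 1)" using \<open>s > 0\<close> by simp
  next
    show "((\<lambda>s::real. - (1 / s ^ n)) \<longlongrightarrow> 0) at_top"
      using tendsto_minus[OF tendsto_inverse_0_at_top[OF filterlim_pow_at_top[OF assms(2) filterlim_ident]]]
      by (simp add: inverse_eq_divide)
  qed simp
  then show ?thesis by simp
qed

text \<open>
  Integration in polar coordinates, reduced to scaling. On the left, the radial integral is rescaled by
  \<open>t = s \<rho>(x)\<close> for each \<open>x\<close>; after exchanging the integrals, \<open>x\<close> is rescaled by \<open>z = s x\<close> for each \<open>s\<close>.
  By homogeneity the condition \<open>\<psi>(x) \<le> 1\<close> becomes \<open>s \<ge> \<psi>(z)\<close>, and the remaining integral of
  \<open>n / s^(n+1)\<close> over \<open>[\<psi>(z), \<infinity>)\<close> is \<open>1 / \<psi>(z)^n\<close>. The radial integral does not depend on \<open>\<psi>\<close>, so ratios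
  of volumes of gauge balls become moments under the density \<open>\<phi> \<circ> \<rho>\<close>.
\<close>

lemma volume_gauge_ball:
  fixes \<rho> \<psi> :: "'a::euclidean_space \<Rightarrow> real" and \<phi> :: "real \<Rightarrow> real"
  assumes meas[measurable]: "\<rho> \<in> borel_measurable borel" "\<psi> \<in> borel_measurable borel" "\<phi> \<in> borel_measurable borel"
    and \<rho>: "gauge_function \<rho>" and \<psi>: "gauge_function \<psi>"
    and \<phi>: "\<And>t. 0 \<le> \<phi> t"
  shows "emeasure lborel {x. \<psi> x \<le> 1} *
           (\<integral>\<^sup>+t. ennreal (DIM('a) * t ^ (DIM('a) - 1) * \<phi> t) * indicator {0<..} t \<partial>lborel)
         = (\<integral>\<^sup>+z. ennreal (\<phi> (\<rho> z)) * ennreal ((\<rho> z / \<psi> z) ^ DIM('a)) \<partial>lborel)"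
proof -
  define n where "n = DIM('a)"
  have n: "0 < n" unfolding n_def by simp
  define C where "C = (\<integral>\<^sup>+t. ennreal (n * t ^ (n - 1) * \<phi> t) * indicator {0<..} t \<partial>lborel)"
  \<comment> \<open>The integrand as a function of the scale and of the rescaled point; the substitution z = s x
    contributes the further factor 1 / s^n.\<close>
  define F where "F s z = ennreal (n / s * \<rho> z ^ n * \<phi> (\<rho> z)) * indicator {0<..} s * indicator {z. \<psi> z \<le> s} z" for s z
  have [measurable]: "(\<lambda>z. F s z) \<in> borel_measurable borel" "(\<lambda>s. F s z) \<in> borel_measurable borel" for s z
    unfolding F_def indicator_def by measurable
  have F2: "(\<lambda>(x, s). F s (s *\<^sub>R x)) \<in> borel_measurable (lborel \<Otimes>\<^sub>M lborel)"
    unfolding F_def case_prod_unfold indicator_def by measurable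
  have F3: "(\<lambda>(s, x). ennreal (1 / s ^ n) * F s x) \<in> borel_measurable (lborel \<Otimes>\<^sub>M lborel)"
    unfolding F_def case_prod_unfold indicator_def by measurable
  have inner: "(\<integral>\<^sup>+s. F s (s *\<^sub>R x) \<partial>lborel) = indicator {x. \<psi> x \<le> 1} x * C" if x: "x \<noteq> 0" for x
  proof -
    have r: "0 < \<rho> x" using gauge_function_pos[OF \<rho> x] .
    define h where "h t = ennreal (n * t ^ (n - 1) * \<phi> t) * indicator {0<..} t" for t :: real
    have h[measurable]: "h \<in> borel_measurable borel" unfolding h_def by measurable
    have C_h: "C = (\<integral>\<^sup>+t. h t \<partial>lborel)" unfolding C_def h_def ..
    have "C = (\<integral>\<^sup>+s. ennreal (\<rho> x) * h (\<rho> x * s) \<partial>lborel)"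
      using nn_integral_real_affine[OF h, of "\<rho> x" 0] r
      by (simp add: C_h nn_integral_cmult)
    then have "indicator {x. \<psi> x \<le> 1} x * C
        = (\<integral>\<^sup>+s. indicator {x. \<psi> x \<le> 1} x * (ennreal (\<rho> x) * h (\<rho> x * s)) \<partial>lborel)"
      by (subst nn_integral_cmult) auto
    also have "\<dots> = (\<integral>\<^sup>+s. F s (s *\<^sub>R x) \<partial>lborel)"
    proof (rule nn_integral_cong)
      fix s :: real
      obtain m where m: "n = Suc m" using n gr0_conv_Suc by blast
      show "indicator {x. \<psi> x \<le> 1} x * (ennreal (\<rho> x) * h (\<rho> x * s)) = F s (s *\<^sub>R x)"
      proof (cases "s > 0")
        case True
        have "\<rho> x * (n * (\<rho> x * s) ^ (n - 1) * \<phi> (\<rho> x * s)) = n / s * (s * \<rho> x) ^ n * \<phi> (s * \<rho> x)"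
          using True by (simp add: m field_simps)
        moreover have "0 < \<rho> x * s" using r True by simp
        moreover have "s * \<psi> x \<le> s \<longleftrightarrow> \<psi> x \<le> 1"
          using True mult_le_cancel_left_pos[of s "\<psi> x" 1] by simp
        ultimately show ?thesis
          using True r by (simp add: F_def h_def gauge_function_scaleR[OF \<rho>] gauge_function_scaleR[OF \<psi>] indicator_def
              flip: ennreal_mult')
      next
        case False
        then have "\<not> 0 < \<rho> x * s" using r by (simp add: zero_less_mult_iff)
        then show ?thesis using False by (simp add: F_def h_def)
      qed
    qed
    finally show ?thesis ..
  qed
  have outer: "(\<integral>\<^sup>+s. ennreal (1 / s ^ n) * F s z \<partial>lborel) = ennreal (\<phi> (\<rho> z)) * ennreal ((\<rho> z / \<psi> z) ^ n)" if z: "z \<noteq> 0" for z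
  proof -
    have pos: "0 < \<rho> z" "0 < \<psi> z" using gauge_function_pos[OF \<rho> z] gauge_function_pos[OF \<psi> z] by auto
    have "(\<integral>\<^sup>+s. ennreal (1 / s ^ n) * F s z \<partial>lborel)
        = (\<integral>\<^sup>+s. ennreal (\<rho> z ^ n * \<phi> (\<rho> z)) * (ennreal (real n / s ^ (n + 1)) * indicator {\<psi> z..} s) \<partial>lborel)"
    proof (rule nn_integral_cong)
      fix s :: real
      show "ennreal (1 / s ^ n) * F s z =
          ennreal (\<rho> z ^ n * \<phi> (\<rho> z)) * (ennreal (real n / s ^ (n + 1)) * indicator {\<psi> z..} s)"
      proof (cases "\<psi> z \<le> s")
        case True
        then have "0 < s" using pos by simp
        moreover have "1 / s ^ n * (n / s * \<rho> z ^ n * \<phi> (\<rho> z)) = \<rho> z ^ n * \<phi> (\<rho> z) * (n / s ^ (n + 1))"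
          by (simp add: mult_ac)
        moreover have "0 \<le> 1 / s ^ n" "0 \<le> \<rho> z ^ n * \<phi> (\<rho> z)"
          using \<open>0 < s\<close> pos \<phi> by auto
        ultimately show ?thesis using True
          by (simp add: F_def del: power_Suc flip: ennreal_mult')
      qed (simp add: F_def)
    qed
    also have "\<dots> = ennreal (\<rho> z ^ n * \<phi> (\<rho> z)) * ennreal (1 / \<psi> z ^ n)"
      using nn_integral_power_tail[OF pos(2) n] by (subst nn_integral_cmult) auto
    also have "\<dots> = ennreal (\<phi> (\<rho> z)) * ennreal ((\<rho> z / \<psi> z) ^ n)"
      using pos \<phi> by (simp add: ennreal_mult'[symmetric] field_simps)
    finally show ?thesis .
  qed
  have AE0: "AE x in lborel. x \<noteq> (0::'a)"
    by (rule AE_lborel_singleton)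
  have "emeasure lborel {x. \<psi> x \<le> 1} * C = (\<integral>\<^sup>+x. indicator {x. \<psi> x \<le> 1} x * C \<partial>lborel)"
    by (simp add: nn_integral_multc)
  also have "\<dots> = (\<integral>\<^sup>+x. \<integral>\<^sup>+s. F s (s *\<^sub>R x) \<partial>lborel \<partial>lborel)"
    using AE0 by (intro nn_integral_cong_AE) (auto simp: inner)
  also have "\<dots> = (\<integral>\<^sup>+s. \<integral>\<^sup>+x. F s (s *\<^sub>R x) \<partial>lborel \<partial>lborel)"
    by (rule lborel_pair.Fubini'[symmetric]) (rule F2)
  also have "\<dots> = (\<integral>\<^sup>+s. \<integral>\<^sup>+x. ennreal (1 / s ^ n) * F s x \<partial>lborel \<partial>lborel)"
  proof (rule nn_integral_cong)
    fix s :: real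
    show "(\<integral>\<^sup>+x. F s (s *\<^sub>R x) \<partial>lborel) = (\<integral>\<^sup>+x. ennreal (1 / s ^ n) * F s x \<partial>lborel)"
    proof (cases "s > 0")
      case True
      then show ?thesis
        by (simp add: nn_integral_cmult nn_integral_lborel_scaleR[of "F s", OF _ True] mult.assoc[symmetric]
            ennreal_mult'[symmetric] n_def)
    qed (simp add: F_def)
  qed
  also have "\<dots> = (\<integral>\<^sup>+x. \<integral>\<^sup>+s. ennreal (1 / s ^ n) * F s x \<partial>lborel \<partial>lborel)"
    by (rule lborel_pair.Fubini'[symmetric]) (use F3 in measurable)
  also have "\<dots> = (\<integral>\<^sup>+z. ennreal (\<phi> (\<rho> z)) * ennreal ((\<rho> z / \<psi> z) ^ n) \<partial>lborel)"
    using AE0 by (intro nn_integral_cong_AE) (auto simp: outer)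
  finally show ?thesis by (simp add: C_def n_def)
qed

lemma emeasure_uniform_root_le:
  fixes a r :: real
  assumes n: "0 < n" and r: "0 < r"
  shows "emeasure (uniform_measure lborel {0..1}) {u. u powr (1 / real n) * r \<le> a}
       = (if a \<le> 0 then 0 else ennreal ((min 1 (a / r)) ^ n))"
proof -
  let ?S = "{0..1} \<inter> {u. u powr (1 / real n) * r \<le> a}"
  have [measurable]: "{u. u powr (1 / real n) * r \<le> a} \<in> sets borel" by measurable
  have eq: "emeasure (uniform_measure lborel {0..1}) {u. u powr (1 / real n) * r \<le> a} = emeasure lborel ?S"
    by (simp add: emeasure_uniform_measure divide_ennreal_def)
  show ?thesis
  proof (cases "a \<le> 0")
    case True
    have "?S \<subseteq> {0}"
    proof
      fix u assume u: "u \<in> ?S"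
      then have "u powr (1 / real n) * r \<le> 0" using True by auto
      then have "u powr (1 / real n) \<le> 0" using r by (simp add: mult_le_0_iff)
      then show "u \<in> {0}" by (metis powr_ge_zero powr_eq_0_iff antisym singletonI)
    qed
    then have "emeasure lborel ?S \<le> emeasure lborel {0::real}" by (intro emeasure_mono) auto
    then show ?thesis using True eq by simp
  next
    case False
    have "u powr (1 / real n) * r \<le> a \<longleftrightarrow> u \<le> (a / r) ^ n" if u: "0 \<le> u" for u
    proof -
      have root: "(u powr (1 / real n)) ^ n = u"
        using n u by (cases "u = 0") (auto simp: powr_powr simp flip: powr_realpow)
      have "u powr (1 / real n) * r \<le> a \<longleftrightarrow> u powr (1 / real n) \<le> a / r"
        using r by (simp add: field_simps)
      also have "\<dots> \<longleftrightarrow> (u powr (1 / real n)) ^ n \<le> (a / r) ^ n"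
        using n r False by (subst power_mono_iff) auto
      finally show ?thesis by (simp add: root)
    qed
    then have "?S = {0..min 1 ((a / r) ^ n)}" by auto
    moreover have "min 1 ((a / r) ^ n) = (min 1 (a / r)) ^ n"
    proof (cases "a / r \<le> 1")
      case True
      then have "(a / r) ^ n \<le> 1" using False r by (intro power_le_one) auto
      then show ?thesis using True by (simp add: min_def)
    next
      case F: False
      then have "1 \<le> (a / r) ^ n" by (intro one_le_power) auto
      then show ?thesis using F by (simp add: min_def antisym)
    qed
    moreover have "0 \<le> min 1 (a / r)" using False r by simp
    ultimately show ?thesis using False eq by simp
  qed
qed

text \<open>
  It suffices to compare distribution functions. Let \<open>Z\<close> have the density \<open>\<phi> \<circ> \<rho>\<close>.
  For \<open>a > 0\<close> the set \<open>{\<rho> \<le> 1, \<tau> \<le> a}\<close> is the unit ball of the gauge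
  \<open>\<psi> = max \<rho> (\<tau>/a)\<close>,
  whose volume is given by \<open>volume_gauge_ball\<close> as a multiple of the mean of
  \<open>(\<rho>(Z)/\<psi>(Z))^n = (min 1 (a \<rho>(Z)/\<tau>(Z)))^n\<close>. The last expression is exactly the conditional probability,
  given \<open>Z\<close>, that \<open>U powr (1/n) * (\<tau>(Z)/\<rho>(Z)) \<le> a\<close>. The case \<open>\<psi> = \<rho>\<close> identifies the multiple as the
  volume of the \<open>\<rho>\<close>-ball and shows that this volume is positive and finite.
  This is the Schechtman--Zinn representation of a uniform point of \<open>{\<rho> \<le> 1}\<close> as
  \<open>U powr (1/n) *\<^sub>R Z /\<^sub>R \<rho>(Z)\<close>, seen through one gauge \<open>\<tau>\<close>.
\<close>

lemma distr_gauge_uniform_ball: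
  fixes \<rho> \<tau> :: "'a::euclidean_space \<Rightarrow> real" and \<phi> :: "real \<Rightarrow> real"
  assumes meas[measurable]: "\<rho> \<in> borel_measurable borel" "\<tau> \<in> borel_measurable borel" "\<phi> \<in> borel_measurable borel"
    and \<rho>: "gauge_function \<rho>" and \<tau>: "gauge_function \<tau>"
    and \<phi>: "\<And>t. 0 \<le> \<phi> t"
    and prob: "prob_space (density lborel (\<lambda>z. ennreal (\<phi> (\<rho> z))))"
  shows "distr (uniform_measure lborel {x. \<rho> x \<le> 1}) borel \<tau>
      = distr (uniform_measure lborel {0..1} \<Otimes>\<^sub>M density lborel (\<lambda>z. ennreal (\<phi> (\<rho> z)))) borel
          (\<lambda>(u, z). u powr (1 / DIM('a)) * (\<tau> z / \<rho> z))" (is "?L = ?R")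
proof -
  define n where "n = DIM('a)"
  have n: "0 < n" unfolding n_def by simp
  define C where "C = (\<integral>\<^sup>+t. ennreal (n * t ^ (n - 1) * \<phi> t) * indicator {0<..} t \<partial>lborel)"
  define V where "V = emeasure lborel {x. \<rho> x \<le> 1}"
  define D where "D = density lborel (\<lambda>z. ennreal (\<phi> (\<rho> z)))"
  have sets_D[measurable_cong]: "sets D = sets borel" and sp_D: "space D = UNIV" by (simp_all add: D_def)
  have volume: "emeasure lborel {x. \<psi> x \<le> 1} * C = (\<integral>\<^sup>+z. ennreal ((\<rho> z / \<psi> z) ^ n) \<partial>D)"
    if [measurable]: "\<psi> \<in> borel_measurable borel" and \<psi>: "gauge_function \<psi>" for \<psi>
    using volume_gauge_ball[of \<rho> \<psi> \<phi>] \<rho> \<psi> \<phi>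
    by (simp add: C_def D_def nn_integral_density flip: n_def)
  have AE0: "AE z in D. z \<noteq> 0"
    unfolding D_def using AE_lborel_singleton[of "0::'a"] by (subst AE_density) auto
  interpret D: prob_space D using prob by (simp add: D_def)
  have "V * C = (\<integral>\<^sup>+z. ennreal ((\<rho> z / \<rho> z) ^ n) \<partial>D)"
    using volume[OF _ \<rho>] by (simp add: V_def)
  also have "\<dots> = (\<integral>\<^sup>+z. 1 \<partial>D)"
  proof (rule nn_integral_cong_AE, use AE0 in eventually_elim)
    fix z :: 'a assume "z \<noteq> 0"
    then show "ennreal ((\<rho> z / \<rho> z) ^ n) = 1" using gauge_function_pos[OF \<rho>, of z] by simp
  qed
  finally have VC: "V * C = 1" by (simp add: D.emeasure_space_1)
  then have V: "V \<noteq> 0" "V \<noteq> \<infinity>" "C \<noteq> 0"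
    by (auto simp: ennreal_top_mult split: if_splits)
  have [measurable]: "{x. \<rho> x \<le> 1} \<in> sets borel" by measurable
  have P: "prob_space (uniform_measure lborel {x. \<rho> x \<le> 1})"
    using V by (intro prob_space_uniform_measure) (auto simp: V_def)
  define W where "W = uniform_measure lborel {x. \<rho> x \<le> 1}"
  have sets_W[measurable_cong]: "sets W = sets borel" and sp_W: "space W = UNIV" by (simp_all add: W_def)
  interpret W: prob_space W using P by (simp add: W_def)
  interpret U: prob_space "uniform_measure lborel {0..1::real}"
    by (intro prob_space_uniform_measure) auto
  define Q where "Q = uniform_measure lborel {0..1::real} \<Otimes>\<^sub>M D"
  interpret Q: pair_prob_space "uniform_measure lborel {0..1::real}" D ..
  have Q_prob: "prob_space Q" unfolding Q_def by unfold_locales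
  have f_meas[measurable]: "(\<lambda>(u, z). u powr (1 / n) * (\<tau> z / \<rho> z)) \<in> borel_measurable Q"
    unfolding Q_def by measurable
  have "emeasure W {x. \<tau> x \<le> a} = emeasure Q {(u, z). u powr (1 / n) * (\<tau> z / \<rho> z) \<le> a}" for a
  proof -
    have S: "{(u, z). u powr (1 / n) * (\<tau> z / \<rho> z) \<le> a} \<in> sets Q"
    proof -
      have "{(u, z). u powr (1 / n) * (\<tau> z / \<rho> z) \<le> a}
          = (\<lambda>(u, z). u powr (1 / n) * (\<tau> z / \<rho> z)) -` {..a} \<inter> space Q"
        by (auto simp: Q_def space_pair_measure sp_D)
      then show ?thesis using measurable_sets[OF f_meas, of "{..a}"] by simp
    qed
    have "emeasure Q {(u, z). u powr (1 / n) * (\<tau> z / \<rho> z) \<le> a}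
        = (\<integral>\<^sup>+z. emeasure (uniform_measure lborel {0..1}) {u. u powr (1 / n) * (\<tau> z / \<rho> z) \<le> a} \<partial>D)"
      unfolding Q_def by (subst Q.emeasure_pair_measure_alt2[OF S[unfolded Q_def]]) (auto intro!: nn_integral_cong arg_cong2[where f = emeasure])
    also have "\<dots> = (\<integral>\<^sup>+z. (if a \<le> 0 then 0 else ennreal ((min 1 (a / (\<tau> z / \<rho> z))) ^ n)) \<partial>D)"
    proof (rule nn_integral_cong_AE, use AE0 in eventually_elim)
      fix z :: 'a assume "z \<noteq> 0"
      then have "0 < \<tau> z / \<rho> z" using gauge_function_pos[OF \<rho>] gauge_function_pos[OF \<tau>] by simp
      then show "emeasure (uniform_measure lborel {0..1}) {u. u powr (1 / n) * (\<tau> z / \<rho> z) \<le> a}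
          = (if a \<le> 0 then 0 else ennreal ((min 1 (a / (\<tau> z / \<rho> z))) ^ n))"
        by (rule emeasure_uniform_root_le[OF n])
    qed
    also have "\<dots> = emeasure W {x. \<tau> x \<le> a}"
    proof (cases "a \<le> 0")
      case True
      have "{x. \<tau> x \<le> a} \<subseteq> {0}"
        using True gauge_function_pos[OF \<tau>] by force
      then have W_le: "emeasure W {x. \<tau> x \<le> a} \<le> emeasure W {0}"
        by (intro emeasure_mono) (auto simp: sets_W)
      have "emeasure lborel ({x. \<rho> x \<le> 1} \<inter> {0}) = 0"
        using emeasure_mono[of "{x. \<rho> x \<le> 1} \<inter> {0}" "{0}" lborel] by simp
      then have W0: "emeasure W {0} = 0"
        unfolding W_def by (subst emeasure_uniform_measure) auto
      show ?thesis using W_le W0 True by simp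
    next
      case False
      define \<psi> where "\<psi> x = max (\<rho> x) (\<tau> x / a)" for x
      have [measurable]: "\<psi> \<in> borel_measurable borel" unfolding \<psi>_def by measurable
      have \<psi>: "gauge_function \<psi>"
        using \<rho> \<tau> False by (auto simp: gauge_function_def \<psi>_def less_max_iff_disj max_mult_distrib_left)
      have "emeasure W {x. \<tau> x \<le> a} = emeasure lborel ({x. \<rho> x \<le> 1} \<inter> {x. \<tau> x \<le> a}) / V"
        unfolding W_def V_def by (subst emeasure_uniform_measure) auto
      also have "{x. \<rho> x \<le> 1} \<inter> {x. \<tau> x \<le> a} = {x. \<psi> x \<le> 1}"
        using False by (auto simp: \<psi>_def)
      also have "emeasure lborel {x. \<psi> x \<le> 1} / V = (emeasure lborel {x. \<psi> x \<le> 1} * C) * V / V"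
        by (simp add: mult.assoc mult.commute[of C] VC)
      also have "\<dots> = emeasure lborel {x. \<psi> x \<le> 1} * C"
        using V by (intro mult_divide_eq_ennreal) auto
      also have "\<dots> = (\<integral>\<^sup>+z. ennreal ((\<rho> z / \<psi> z) ^ n) \<partial>D)"
        using \<psi> by (intro volume) auto
      also have "\<dots> = (\<integral>\<^sup>+z. ennreal ((min 1 (a / (\<tau> z / \<rho> z))) ^ n) \<partial>D)"
      proof (rule nn_integral_cong_AE, use AE0 in eventually_elim)
        fix z :: 'a assume "z \<noteq> 0"
        then have "0 < \<rho> z" "0 < \<tau> z" using gauge_function_pos[OF \<rho>] gauge_function_pos[OF \<tau>] by auto
        then have "\<rho> z / \<psi> z = min 1 (a / (\<tau> z / \<rho> z))"
          using False by (auto simp: \<psi>_def max_def min_def field_simps)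
        then show "ennreal ((\<rho> z / \<psi> z) ^ n) = ennreal ((min 1 (a / (\<tau> z / \<rho> z))) ^ n)" by simp
      qed
      finally show ?thesis using False by simp
    qed
    finally show ?thesis by simp
  qed
  then have cdf: "cdf (distr W borel \<tau>) a = cdf (distr Q borel (\<lambda>(u, z). u powr (1 / n) * (\<tau> z / \<rho> z))) a" for a
    by (simp add: cdf_def measure_def emeasure_distr vimage_def Q_def space_pair_measure sp_W sp_D case_prod_unfold)
  have "distr W borel \<tau> = distr Q borel (\<lambda>(u, z). u powr (1 / n) * (\<tau> z / \<rho> z))"
  proof (rule cdf_unique)
    show "real_distribution (distr W borel \<tau>)"
      by (auto simp: real_distribution_def real_distribution_axioms_def intro!: W.prob_space_distr)
    show "real_distribution (distr Q borel (\<lambda>(u, z). u powr (1 / n) * (\<tau> z / \<rho> z)))"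
      using prob_space.prob_space_distr[OF Q_prob f_meas]
      by (simp add: real_distribution_def real_distribution_axioms_def)
  qed (simp add: cdf fun_eq_iff)
  then show "?L = ?R" by (simp add: W_def Q_def D_def n_def)
qed

section \<open>The p-norm and p-Gaussian vectors\<close>

lemma gauge_function_norm: "gauge_function (norm :: 'a::real_normed_vector \<Rightarrow> real)"
  by (simp add: gauge_function_def)

lemma gauge_function_lp_norm:
  assumes p: "0 < p"
  shows "gauge_function (lp_norm p :: real ^ 'n \<Rightarrow> real)"
  unfolding gauge_function_def
proof (intro conjI allI impI)
  fix x :: "real ^ 'n" assume "x \<noteq> 0"
  then obtain j where "x $ j \<noteq> 0" by (auto simp: vec_eq_iff)
  then have "0 < (\<Sum>i\<in>UNIV. \<bar>x $ i\<bar> powr p)" by (intro sum_pos2[of _ j]) auto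
  then show "0 < lp_norm p x" by (simp add: lp_norm_def)
next
  fix s :: real and x :: "real ^ 'n" assume "0 < s"
  then show "lp_norm p (s *\<^sub>R x) = s * lp_norm p x"
    using p by (simp add: lp_norm_def abs_mult powr_mult sum_nonneg powr_powr flip: sum_distrib_left)
qed

lemma lp_norm_powr:
  assumes p: "0 < p"
  shows "lp_norm p x powr p = (\<Sum>i\<in>UNIV. \<bar>x $ i\<bar> powr p)"
  using p by (simp add: lp_norm_def powr_powr sum_nonneg)

lemma borel_measurable_vec_nth[measurable]: "(\<lambda>x :: real ^ 'n. x $ i) \<in> borel_measurable borel"
  by (intro borel_measurable_continuous_onI continuous_intros)

lemma borel_measurable_lp_norm[measurable]: "lp_norm p \<in> borel_measurable borel"
  unfolding lp_norm_def by measurable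

text \<open>
  The joint density of \<open>n\<close> independent \<open>p\<close>-Gaussian coordinates as a function of their \<open>p\<close>-norm \<open>t\<close>.
\<close>

definition p_gaussian_profile :: "real \<Rightarrow> nat \<Rightarrow> real \<Rightarrow> real" where
  "p_gaussian_profile p n t = (1 / (2 * p powr (1 / p) * Gamma (1 + 1 / p))) ^ n * exp (- (t powr p) / p)"

lemma p_gaussian_constant_nonneg:
  fixes p :: real
  assumes "1 \<le> p"
  shows "0 \<le> 1 / (2 * p powr (1 / p) * Gamma (1 + 1 / p))"
proof -
  have "0 < Gamma (1 + 1 / p)" using assms by (intro Gamma_real_pos add_pos_nonneg) auto
  then show ?thesis by simp
qed

lemma p_gaussian_profile_nonneg: "1 \<le> p \<Longrightarrow> 0 \<le> p_gaussian_profile p n t"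
  unfolding p_gaussian_profile_def by (intro mult_nonneg_nonneg zero_le_power p_gaussian_constant_nonneg) auto

lemma p_gaussian_density_nonneg: "1 \<le> p \<Longrightarrow> 0 \<le> p_gaussian_density p t"
  unfolding p_gaussian_density_def by (intro mult_nonneg_nonneg p_gaussian_constant_nonneg) auto

lemma prod_p_gaussian_density:
  fixes x :: "real ^ 'n"
  assumes p: "1 \<le> p"
  shows "(\<Prod>j\<in>UNIV. p_gaussian_density p (x $ j)) = p_gaussian_profile p CARD('n) (lp_norm p x)"
proof -
  have "(\<Prod>j\<in>UNIV. exp (- (\<bar>x $ j\<bar> powr p) / p)) = exp (- (lp_norm p x powr p) / p)"
    using p by (simp add: lp_norm_powr sum_negf sum_divide_distrib flip: exp_sum)
  then show ?thesis
    unfolding p_gaussian_density_def p_gaussian_profile_def prod.distrib by simp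
qed

section \<open>Gaussian vectors and Haar distributed rotations\<close>

definition gaussian_measure :: "(real ^ 'n) measure" where
  "gaussian_measure = density lborel (\<lambda>x. ennreal (\<Prod>j\<in>UNIV. std_normal_density (x $ j)))"

lemma sets_gaussian_measure[simp, measurable_cong]: "sets gaussian_measure = sets borel"
  and space_gaussian_measure[simp]: "space gaussian_measure = UNIV"
  by (simp_all add: gaussian_measure_def)

lemma prob_space_gaussian_measure: "prob_space (gaussian_measure :: (real ^ 'n) measure)"
proof
  interpret product_sigma_finite "\<lambda>_::'n. lborel :: real measure" ..
  have vec: "(\<lambda>f. \<chi> j. f j) \<in> measurable (\<Pi>\<^sub>M j\<in>(UNIV::'n set). lborel) (borel :: (real ^ 'n) measure)"
    by (rule borel_measurable_vec_lambda) simp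
  have "emeasure (gaussian_measure :: (real ^ 'n) measure) UNIV
      = integral\<^sup>N lborel (\<lambda>x :: real ^ 'n. ennreal (\<Prod>j\<in>UNIV. std_normal_density (x $ j)))"
    by (simp add: gaussian_measure_def emeasure_density)
  also have "\<dots> = (\<integral>\<^sup>+f. (\<Prod>j\<in>(UNIV :: 'n set). ennreal (std_normal_density (f j))) \<partial>(\<Pi>\<^sub>M j\<in>UNIV. lborel))"
    unfolding lborel_vec_eq_PiM using vec by (subst nn_integral_distr) (auto simp: prod_ennreal)
  also have "\<dots> = (\<Prod>j\<in>(UNIV :: 'n set). \<integral>\<^sup>+t. ennreal (std_normal_density t) \<partial>lborel)"
    by (rule product_nn_integral_prod) auto
  also have "(\<integral>\<^sup>+t. ennreal (std_normal_density t) \<partial>lborel) = 1"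
    using prob_space.emeasure_space_1[OF prob_space_normal_density[of 1 0]] by (simp add: emeasure_density)
  finally show "emeasure (gaussian_measure :: (real ^ 'n) measure) (space gaussian_measure) = 1" by simp
qed

lemma prod_std_normal_density:
  fixes x :: "real ^ 'n"
  shows "(\<Prod>j\<in>UNIV. std_normal_density (x $ j)) = (1 / sqrt (2 * pi)) ^ CARD('n) * exp (- (norm x)\<^sup>2 / 2)"
proof -
  have "(\<Prod>j\<in>UNIV. std_normal_density (x $ j)) = (1 / sqrt (2 * pi)) ^ CARD('n) * (\<Prod>j\<in>UNIV. exp (- (x $ j)\<^sup>2 / 2))"
    unfolding std_normal_density_def prod.distrib by simp
  also have "(\<Prod>j\<in>UNIV. exp (- (x $ j)\<^sup>2 / 2)) = exp (\<Sum>j\<in>UNIV. - (x $ j)\<^sup>2 / 2)"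
    by (simp add: exp_sum)
  also have "(\<Sum>j\<in>UNIV. - (x $ j)\<^sup>2 / 2) = - (norm x)\<^sup>2 / 2"
    by (simp add: norm_vec_def L2_set_def sum_nonneg sum_negf sum_divide_distrib)
  finally show ?thesis .
qed

lemma distr_gaussian_orthogonal_transformation:
  fixes f :: "real ^ 'n \<Rightarrow> real ^ 'n"
  assumes f: "orthogonal_transformation f"
  shows "distr gaussian_measure borel f = gaussian_measure"
proof -
  let ?d = "\<lambda>x::real ^ 'n. ennreal (\<Prod>j\<in>UNIV. std_normal_density (x $ j))"
  have f_meas: "f \<in> measurable lborel borel"
    using orthogonal_transformation_linear[OF f]
    by (simp add: borel_measurable_continuous_onI linear_continuous_on linear_linear)
  have "norm (f x) = norm x" for x using f by (simp add: orthogonal_transformation)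
  then have "?d = (\<lambda>x. ?d (f x))" by (simp add: prod_std_normal_density)
  then have "distr gaussian_measure borel f = distr (density lborel (\<lambda>x. ?d (f x))) borel f"
    by (simp add: gaussian_measure_def)
  also have "\<dots> = density (distr lborel borel f) ?d"
    using f_meas by (subst density_distr) auto
  also have "\<dots> = gaussian_measure"
    by (simp add: lborel_distr_orthogonal_transformation[OF f] gaussian_measure_def)
  finally show ?thesis .
qed

lemma continuous_on_transpose_mult:
  fixes F :: "'a::topological_space \<Rightarrow> real ^ 'n ^ 'm"
  assumes "continuous_on S F" "continuous_on S G"
  shows "continuous_on S (\<lambda>a. transpose (F a) *v G a)"
  unfolding matrix_vector_mult_def transpose_def using assms
  by (auto intro!: continuous_intros)

lemma SO_transpose_orthogonal: "T \<in> SO \<Longrightarrow> orthogonal_transformation (\<lambda>x. transpose T *v x)"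
  by (auto simp: SO_def rotation_matrix_def orthogonal_transformation_matrix orthogonal_matrix_transpose
      simp del: transpose_matrix_vector)

lemma SO_mult: "S \<in> SO \<Longrightarrow> T \<in> SO \<Longrightarrow> S ** T \<in> SO"
  by (auto simp: SO_def rotation_matrix_def orthogonal_matrix_mul det_mul)

text \<open>
  The sign is there for dimension one, where the only rotation is the identity and the sphere
  consists of two points.
\<close>

lemma SO_transitive:
  fixes x y :: "real ^ 'n"
  assumes xy: "norm x = norm y"
  obtains S where "S \<in> SO" "transpose S *v y = x \<or> transpose S *v y = - x"
proof (cases "2 \<le> CARD('n)")
  case True
  obtain f where f: "orthogonal_transformation f" "det (matrix f) = 1" "f x = y"
    using rotation_exists[OF True xy] .
  then have "matrix f \<in> SO" by (simp add: SO_def rotation_matrix_def orthogonal_transformation_matrix)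
  moreover have "transpose (matrix f) *v y = x"
  proof -
    have "y = matrix f *v x"
      using f by (simp add: matrix_works orthogonal_transformation_linear)
    then show ?thesis
      using \<open>matrix f \<in> SO\<close>
      by (simp add: matrix_vector_mul_assoc SO_def rotation_matrix_def orthogonal_matrix)
  qed
  ultimately show ?thesis using that by blast
next
  case False
  moreover have "0 < CARD('n)" by (rule zero_less_card_finite)
  ultimately have "CARD('n) = 1" by linarith
  then obtain a where a: "(UNIV :: 'n set) = {a}" by (auto simp: card_1_singleton_iff)
  have nrm: "norm z = \<bar>z $ a\<bar>" for z :: "real ^ 'n"
    by (simp add: norm_vec_def L2_set_def a)
  have all: "(\<forall>j::'n. P j) \<longleftrightarrow> P a" for P
    using a by (metis UNIV_I singletonD)
  have "y = x \<or> y = - x"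
    using xy by (auto simp: nrm vec_eq_iff all abs_eq_iff)
  moreover have "mat 1 \<in> SO"
    by (simp add: SO_def rotation_matrix_def orthogonal_matrix_id)
  ultimately show ?thesis using that[of "mat 1"] by (auto simp: transpose_mat)
qed

text \<open>
  Left invariance acts on \<open>T\<^sup>t x\<close> through \<open>(S T)\<^sup>t y = T\<^sup>t (S\<^sup>t y)\<close>. As the rotations are transitive on
  spheres up to sign and \<open>q\<close> is even, the law of \<open>q(T\<^sup>t x)\<close> depends on \<open>x\<close> only through its norm. So \<open>x\<close> may
  be replaced by an independent Gaussian vector \<open>y\<close> rescaled to the norm of \<open>x\<close>. For each fixed \<open>T\<close> the vector \<open>T\<^sup>t y\<close>
  is Gaussian with the norm of \<open>y\<close>, so after exchanging the integrals the rotation disappears.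
\<close>

lemma distr_haar_homogeneous:
  fixes \<mu> :: "(real ^ 'n ^ 'n) measure" and q :: "real ^ 'n \<Rightarrow> real"
  assumes \<mu>: "haar_prob_SO \<mu>"
    and q[measurable]: "q \<in> borel_measurable borel"
    and hom: "\<And>c y. q (c *\<^sub>R y) = \<bar>c\<bar> * q y"
  shows "distr \<mu> borel (\<lambda>T. q (transpose T *v x)) = distr gaussian_measure borel (\<lambda>y. norm x * (q y / norm y))"
proof -
  interpret \<mu>: prob_space \<mu> using \<mu> by (simp add: haar_prob_SO_def)
  interpret G: prob_space "gaussian_measure :: (real ^ 'n) measure" by (rule prob_space_gaussian_measure)
  interpret P: pair_prob_space \<mu> "gaussian_measure :: (real ^ 'n) measure" ..
  have sets_\<mu>: "sets \<mu> = sets (restrict_space borel SO)" using \<mu> by (simp add: haar_prob_SO_def)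
  then have sp: "space \<mu> = SO" by (auto dest: sets_eq_imp_space_eq simp: space_restrict_space)
  have id_\<mu>[measurable]: "(\<lambda>T. T) \<in> measurable \<mu> borel"
    using measurable_restrict_space1[of "\<lambda>T. T" borel borel SO] by (simp cong: measurable_cong_sets[OF sets_\<mu>])
  have tr: "(\<lambda>(T, y). transpose T *v y) \<in> measurable (borel \<Otimes>\<^sub>M borel) (borel :: (real ^ 'n) measure)"
    unfolding borel_prod case_prod_unfold
    by (intro borel_measurable_continuous_onI continuous_on_transpose_mult continuous_intros)
  have tr_meas: "(\<lambda>(T, y). transpose T *v y) \<in> measurable (\<mu> \<Otimes>\<^sub>M borel) (borel :: (real ^ 'n) measure)"
  proof -
    have "(\<lambda>p. (fst p, snd p)) \<in> measurable (\<mu> \<Otimes>\<^sub>M borel) (borel \<Otimes>\<^sub>M (borel :: (real ^ 'n) measure))"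
      by (intro measurable_Pair measurable_compose[OF measurable_fst id_\<mu>] measurable_snd)
    from measurable_compose[OF this tr] show ?thesis by (simp add: case_prod_unfold)
  qed
  have tr1: "(\<lambda>T. transpose T *v x) \<in> measurable \<mu> borel" for x :: "real ^ 'n"
    using measurable_compose[OF measurable_Pair2'[of x borel \<mu>] tr_meas] by simp
  have tr2: "(\<lambda>y. transpose T *v y) \<in> measurable borel (borel :: (real ^ 'n) measure)" for T :: "real ^ 'n ^ 'n"
    by (intro borel_measurable_continuous_onI continuous_on_transpose_mult continuous_intros)
  have left: "(\<lambda>T. S ** T) \<in> measurable \<mu> \<mu>" if S: "S \<in> SO" for S
  proof -
    have "(\<lambda>T. S ** T) \<in> borel_measurable (borel :: (real ^ 'n ^ 'n) measure)"
      unfolding matrix_matrix_mult_def by (intro borel_measurable_continuous_onI continuous_intros)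
    then have "(\<lambda>T. S ** T) \<in> borel_measurable \<mu>" using measurable_compose[OF id_\<mu>] by blast
    then have "(\<lambda>T. S ** T) \<in> measurable \<mu> (restrict_space borel SO)"
      using S by (intro measurable_restrict_space2) (auto simp: sp SO_mult)
    then show ?thesis by (simp cong: measurable_cong_sets[OF refl sets_\<mu>])
  qed
  have radial: "(\<integral>\<^sup>+T. h (q (transpose T *v x)) \<partial>\<mu>) = (\<integral>\<^sup>+T. h (q (transpose T *v y)) \<partial>\<mu>)"
    if h[measurable]: "h \<in> borel_measurable borel" and xy: "norm x = norm y" for h :: "real \<Rightarrow> ennreal" and x y
  proof -
    obtain S where S: "S \<in> SO" "transpose S *v y = x \<or> transpose S *v y = - x"
      using SO_transitive[OF xy] .
    have "q (transpose T *v (- x)) = q (transpose T *v x)" for T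
      using hom[of "-1" "transpose T *v x"] 
        by (simp only: linear_neg[OF matrix_vector_mul_linear] scaleR_minus1_left abs_neg_one mult_1)
    then have q_S: "q (transpose T *v (transpose S *v y)) = q (transpose T *v x)" for T
      using S(2) by auto
    have "(\<integral>\<^sup>+T. h (q (transpose T *v y)) \<partial>\<mu>) = (\<integral>\<^sup>+T. h (q (transpose T *v y)) \<partial>distr \<mu> \<mu> (\<lambda>T. S ** T))"
      using \<mu> S(1) by (simp add: haar_prob_SO_def)
    also have "\<dots> = (\<integral>\<^sup>+T. h (q (transpose (S ** T) *v y)) \<partial>\<mu>)"
      using left[OF S(1)] tr1 by (subst nn_integral_distr) (auto intro: measurable_compose[OF tr1])
    also have "\<dots> = (\<integral>\<^sup>+T. h (q (transpose T *v x)) \<partial>\<mu>)"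
      by (simp only: matrix_transpose_mul matrix_vector_mul_assoc[symmetric] q_S)
    finally show ?thesis ..
  qed
  have AE0: "AE y in gaussian_measure. y \<noteq> (0 :: real ^ 'n)"
    unfolding gaussian_measure_def using AE_lborel_singleton[of "0 :: real ^ 'n"] by (subst AE_density) auto
  have main: "(\<integral>\<^sup>+T. h (q (transpose T *v x)) \<partial>\<mu>) = (\<integral>\<^sup>+y. h (norm x * (q y / norm y)) \<partial>gaussian_measure)"
    if h[measurable]: "h \<in> borel_measurable borel" for h :: "real \<Rightarrow> ennreal"
  proof -
    have H: "(\<lambda>(T, y). h (norm x * (q (transpose T *v y) / norm (transpose T *v y)))) \<in> borel_measurable (\<mu> \<Otimes>\<^sub>M gaussian_measure)"
      using measurable_compose[OF tr_meas, of "\<lambda>y. h (norm x * (q y / norm y))" borel]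
      by (simp add: case_prod_unfold cong: measurable_cong_sets sets_pair_measure_cong)
    have "(\<integral>\<^sup>+T. h (q (transpose T *v x)) \<partial>\<mu>) = (\<integral>\<^sup>+y. \<integral>\<^sup>+T. h (q (transpose T *v x)) \<partial>\<mu> \<partial>(gaussian_measure :: (real ^ 'n) measure))"
      using G.emeasure_space_1 by simp
    also have "\<dots> = (\<integral>\<^sup>+y. \<integral>\<^sup>+T. h (norm x * (q (transpose T *v y) / norm (transpose T *v y))) \<partial>\<mu> \<partial>gaussian_measure)"
    proof (rule nn_integral_cong_AE, use AE0 in eventually_elim)
      fix y :: "real ^ 'n" assume y: "y \<noteq> 0"
      have "(\<integral>\<^sup>+T. h (q (transpose T *v x)) \<partial>\<mu>) = (\<integral>\<^sup>+T. h (q (transpose T *v ((norm x / norm y) *\<^sub>R y))) \<partial>\<mu>)"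
        using y by (intro radial h) simp
      also have "\<dots> = (\<integral>\<^sup>+T. h (norm x * (q (transpose T *v y) / norm (transpose T *v y))) \<partial>\<mu>)"
      proof (rule nn_integral_cong)
        fix T assume "T \<in> space \<mu>"
        then have "norm (transpose T *v y) = norm y"
          by (intro orthogonal_transformation_norm SO_transpose_orthogonal) (simp add: sp)
        moreover have "q (transpose T *v ((norm x / norm y) *\<^sub>R y)) = norm x / norm y * q (transpose T *v y)"
          by (simp only: matrix_vector_mult_scaleR hom) simp
        ultimately show "h (q (transpose T *v ((norm x / norm y) *\<^sub>R y)))
            = h (norm x * (q (transpose T *v y) / norm (transpose T *v y)))"
          by (simp only: times_divide_eq_left times_divide_eq_right)
      qed
      finally show "(\<integral>\<^sup>+T. h (q (transpose T *v x)) \<partial>\<mu>)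
          = (\<integral>\<^sup>+T. h (norm x * (q (transpose T *v y) / norm (transpose T *v y))) \<partial>\<mu>)" .
    qed
    also have "\<dots> = (\<integral>\<^sup>+T. \<integral>\<^sup>+y. h (norm x * (q (transpose T *v y) / norm (transpose T *v y))) \<partial>gaussian_measure \<partial>\<mu>)"
      using P.Fubini'[OF H] by simp
    also have "\<dots> = (\<integral>\<^sup>+T. \<integral>\<^sup>+y. h (norm x * (q y / norm y)) \<partial>gaussian_measure \<partial>\<mu>)"
    proof (rule nn_integral_cong)
      fix T assume "T \<in> space \<mu>"
      then have "orthogonal_transformation (\<lambda>y. transpose T *v y)"
        by (intro SO_transpose_orthogonal) (simp add: sp)
      note inv = distr_gaussian_orthogonal_transformation[OF this]
      have [measurable]: "(\<lambda>y. transpose T *v y) \<in> measurable gaussian_measure (borel :: (real ^ 'n) measure)"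
        using tr2 by (simp cong: measurable_cong_sets)
      show "(\<integral>\<^sup>+y. h (norm x * (q (transpose T *v y) / norm (transpose T *v y))) \<partial>gaussian_measure)
          = (\<integral>\<^sup>+y. h (norm x * (q y / norm y)) \<partial>gaussian_measure)"
        by (subst (2) inv[symmetric]) (simp add: nn_integral_distr)
    qed
    also have "\<dots> = (\<integral>\<^sup>+y. h (norm x * (q y / norm y)) \<partial>gaussian_measure)"
      by (simp add: \<mu>.emeasure_space_1)
    finally show ?thesis .
  qed
  show ?thesis
  proof (rule measure_eqI)
    fix A assume "A \<in> sets (distr \<mu> borel (\<lambda>T. q (transpose T *v x)))"
    then have A[measurable]: "A \<in> sets borel" by simp
    have r_meas: "(\<lambda>y. norm x * (q y / norm y)) \<in> borel_measurable gaussian_measure"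
      by measurable
    have q_meas: "(\<lambda>T. q (transpose T *v x)) \<in> borel_measurable \<mu>"
      by (rule measurable_compose[OF tr1 q])
    have "emeasure (distr \<mu> borel (\<lambda>T. q (transpose T *v x))) A = (\<integral>\<^sup>+T. indicator A (q (transpose T *v x)) \<partial>\<mu>)"
      using nn_integral_distr[OF q_meas, of "indicator A"] by simp
    also have "\<dots> = (\<integral>\<^sup>+y. indicator A (norm x * (q y / norm y)) \<partial>gaussian_measure)"
      by (rule main) simp
    also have "\<dots> = emeasure (distr gaussian_measure borel (\<lambda>y. norm x * (q y / norm y))) A"
      using nn_integral_distr[OF r_meas, of "indicator A"] by simp
    finally show "emeasure (distr \<mu> borel (\<lambda>T. q (transpose T *v x))) A = \<dots>" .
  qed simp
qed

section \<open>Orthogonal projection onto a rotated subspace\<close>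

definition coord_proj :: "'n set \<Rightarrow> real ^ 'n \<Rightarrow> real ^ 'n" where
  "coord_proj J w = (\<chi> j. if j \<in> J then w $ j else 0)"

lemma linear_coord_proj: "linear (coord_proj J)"
  by (intro linearI) (auto simp: coord_proj_def vec_eq_iff)

lemma borel_measurable_coord_proj[measurable]: "coord_proj J \<in> borel_measurable borel"
  by (intro borel_measurable_continuous_onI linear_continuous_on_compose[OF continuous_on_id linear_coord_proj])

lemma inner_coord_proj: "coord_proj J x \<bullet> coord_proj J y = x \<bullet> coord_proj J y"
  by (auto simp: coord_proj_def inner_vec_def intro!: sum.cong)

lemma std_subspace_eq: "std_subspace idx k = range (coord_proj (idx ` {1..k}))"
proof
  have sub: "subspace (range (coord_proj (idx ` {1..k})))"
    by (intro linear_subspace_image linear_coord_proj subspace_UNIV)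
  have "axis (idx i) 1 = coord_proj (idx ` {1..k}) (axis (idx i) 1)" if "i \<in> {1..k}" for i
    using that by (auto simp: coord_proj_def vec_eq_iff axis_def)
  then show "std_subspace idx k \<subseteq> range (coord_proj (idx ` {1..k}))"
    unfolding std_subspace_def using sub by (intro span_minimal image_subsetI) (metis rangeI)
  show "range (coord_proj (idx ` {1..k})) \<subseteq> std_subspace idx k"
  proof safe
    fix w
    have "coord_proj (idx ` {1..k}) w = (\<Sum>j\<in>idx ` {1..k}. w $ j *\<^sub>R axis j 1)"
      by (auto simp: coord_proj_def vec_eq_iff axis_def if_distrib[of "\<lambda>t. _ * t"] sum.delta' cong: if_cong)
    also have "\<dots> \<in> std_subspace idx k"
      unfolding std_subspace_def by (intro span_sum span_scale span_base) auto
    finally show "coord_proj (idx ` {1..k}) w \<in> std_subspace idx k" .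
  qed
qed

lemma orth_proj_eqI:
  assumes V: "subspace V" and y: "y \<in> V" "\<And>z. z \<in> V \<Longrightarrow> (x - y) \<bullet> z = 0"
  shows "orth_proj V x = y"
  unfolding orth_proj_def
proof (rule the_equality)
  show "y \<in> V \<and> (\<forall>z\<in>V. orthogonal (x - y) z)" using y by (simp add: orthogonal_def)
  fix y' assume y': "y' \<in> V \<and> (\<forall>z\<in>V. orthogonal (x - y') z)"
  then have "y' - y \<in> V" using V y by (simp add: subspace_diff)
  then have "(x - y) \<bullet> (y' - y) = 0" "(x - y') \<bullet> (y' - y) = 0"
    using y y' by (auto simp: orthogonal_def)
  then have "(y' - y) \<bullet> (y' - y) = 0" by (simp add: inner_diff_left)
  then show "y' = y" by simp
qed

lemma
  assumes V: "subspace V"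
  shows orth_proj_mem: "orth_proj V x \<in> V"
    and inner_orth_proj_diff: "z \<in> V \<Longrightarrow> (x - orth_proj V x) \<bullet> z = 0"
proof -
  have span: "span V = V" using V by (simp add: span_eq_iff)
  obtain y w where yw: "y \<in> span V" "\<And>v. v \<in> span V \<Longrightarrow> orthogonal w v" "x = y + w"
    using orthogonal_subspace_decomp_exists[of V x] by blast
  have "orth_proj V x = y"
    using yw by (intro orth_proj_eqI[OF V]) (auto simp: orthogonal_def span)
  then show "orth_proj V x \<in> V" "z \<in> V \<Longrightarrow> (x - orth_proj V x) \<bullet> z = 0"
    using yw by (auto simp: orthogonal_def span)
qed

lemma linear_orth_proj:
  assumes V: "subspace V"
  shows "linear (orth_proj V)"
proof (rule linearI)
  fix x y :: "real ^ 'a" and c :: real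
  show "orth_proj V (x + y) = orth_proj V x + orth_proj V y"
  proof (rule orth_proj_eqI[OF V])
    fix z assume "z \<in> V"
    then show "(x + y - (orth_proj V x + orth_proj V y)) \<bullet> z = 0"
      using inner_orth_proj_diff[OF V, of z x] inner_orth_proj_diff[OF V, of z y]
      by (simp add: inner_diff_left inner_add_left)
  qed (simp add: subspace_add[OF V] orth_proj_mem[OF V])
  show "orth_proj V (c *\<^sub>R x) = c *\<^sub>R orth_proj V x"
  proof (rule orth_proj_eqI[OF V])
    fix z assume "z \<in> V"
    then show "(c *\<^sub>R x - c *\<^sub>R orth_proj V x) \<bullet> z = 0"
      using inner_orth_proj_diff[OF V, of z x] by (simp flip: scaleR_diff_right)
  qed (simp add: subspace_scale[OF V] orth_proj_mem[OF V])
qed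

lemma rotated_subspace_in_grassmannian:
  fixes idx :: "nat \<Rightarrow> 'n::finite"
  assumes inj: "inj_on idx {1..k}" and T: "T \<in> SO"
  shows "rotated_subspace idx k T \<in> grassmannian k"
proof -
  have inj_T: "inj (\<lambda>x. T *v x)"
    using T by (intro inj_on_inverseI[where g = "\<lambda>x. transpose T *v x"])
      (simp add: SO_def rotation_matrix_def orthogonal_matrix matrix_vector_mul_assoc)
  let ?B = "(\<lambda>i. axis (idx i) (1::real)) ` {1..k}"
  have "independent ?B"
    by (rule independent_mono[OF independent_Basis]) (simp add: image_subset_iff)
  moreover have "card ?B = k"
  proof -
    have "inj_on (\<lambda>i. axis (idx i) (1::real)) {1..k}"
      using inj by (intro inj_onI) (auto simp: axis_eq_axis dest: inj_onD)
    then show ?thesis by (simp add: card_image)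
  qed
  ultimately have "dim (std_subspace idx k) = k"
    by (simp add: std_subspace_def dim_eq_card_independent)
  moreover have "subspace (std_subspace idx k)" by (simp add: std_subspace_def)
  moreover have "dim ((\<lambda>x. T *v x) ` std_subspace idx k) = dim (std_subspace idx k)"
    by (rule dim_image_eq[OF matrix_vector_mul_linear]) (rule inj_on_subset[OF inj_T subset_UNIV])
  moreover have "subspace ((\<lambda>x. T *v x) ` std_subspace idx k)"
    by (rule linear_subspace_image[OF matrix_vector_mul_linear]) fact
  ultimately show ?thesis
    unfolding grassmannian_def rotated_subspace_def by (intro CollectI conjI) (assumption, metis)
qed

text \<open>
  In the coordinates \<open>T\<^sup>t x\<close> the rotated subspace is the standard one, where projecting means discarding
  coordinates.
\<close>

lemma orth_proj_rotated:
  assumes T: "T \<in> SO"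
  shows "orth_proj (rotated_subspace idx k T) x = T *v coord_proj (idx ` {1..k}) (transpose T *v x)"
proof (rule orth_proj_eqI)
  let ?P = "coord_proj (idx ` {1..k})"
  show "subspace (rotated_subspace idx k T)"
    unfolding rotated_subspace_def std_subspace_def by (intro linear_subspace_image) auto
  show "T *v ?P (transpose T *v x) \<in> rotated_subspace idx k T"
    by (auto simp: rotated_subspace_def std_subspace_eq)
  fix z assume "z \<in> rotated_subspace idx k T"
  then obtain w where z: "z = T *v ?P w" by (auto simp: rotated_subspace_def std_subspace_eq)
  have TT: "transpose T *v (T *v v) = v" for v
    using T by (simp add: SO_def rotation_matrix_def orthogonal_matrix matrix_vector_mul_assoc)
  have adj: "a \<bullet> (T *v b) = (transpose T *v a) \<bullet> b" for a b
    by (simp add: dot_lmul_matrix)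
  show "(x - T *v ?P (transpose T *v x)) \<bullet> z = 0"
    by (simp only: z adj inner_diff_left TT matrix_vector_mult_diff_distrib inner_coord_proj diff_self)
qed

lemma inner_orth_proj_rotated:
  assumes T: "T \<in> SO"
  shows "orth_proj (rotated_subspace idx k T) x \<bullet> orth_proj (rotated_subspace idx k T) y
       = (transpose T *v x) \<bullet> coord_proj (idx ` {1..k}) (transpose T *v y)"
proof -
  have "orthogonal_transformation (\<lambda>v. T *v v)"
    using T by (simp add: SO_def rotation_matrix_def orthogonal_transformation_matrix)
  then show ?thesis by (simp only: orth_proj_rotated[OF T] orthogonal_transformation_def inner_coord_proj)
qed

lemma norm_orth_proj_rotated:
  assumes T: "T \<in> SO"
  shows "norm (orth_proj (rotated_subspace idx k T) x) = norm (coord_proj (idx ` {1..k}) (transpose T *v x))"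
  by (simp only: norm_eq_sqrt_inner inner_orth_proj_rotated[OF T] inner_coord_proj)

lemma space_grassmannian_borel: "space (grassmannian_borel idx k) = grassmannian k"
  and sets_grassmannian_borel: "sets (grassmannian_borel idx k) = sigma_sets (grassmannian k)
       {W. W \<subseteq> grassmannian k \<and> openin (top_of_set SO) {T \<in> SO. rotated_subspace idx k T \<in> W}}"
  unfolding grassmannian_borel_def by (auto intro!: space_measure_of sets_measure_of)

text \<open>
  The generators of the \<open>\<sigma>\<close>-algebra are the sets that are open in the quotient topology, so continuity has to be checked only
  after composition with the quotient map.
\<close>

lemma measurable_grassmannian_borelI:
  fixes f :: "(real ^ 'n) set \<Rightarrow> real" and idx :: "nat \<Rightarrow> 'n::finite"
  assumes inj: "inj_on idx {1..k}"
    and cont: "continuous_on SO (\<lambda>T. f (rotated_subspace idx k T))"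
  shows "f \<in> borel_measurable (grassmannian_borel idx k)"
proof (rule borel_measurableI)
  fix S :: "real set" assume S: "open S"
  have "{T \<in> SO. rotated_subspace idx k T \<in> f -` S \<inter> grassmannian k}
      = SO \<inter> (\<lambda>T. f (rotated_subspace idx k T)) -` S"
    using rotated_subspace_in_grassmannian[OF inj] by auto
  then have "openin (top_of_set SO) {T \<in> SO. rotated_subspace idx k T \<in> f -` S \<inter> grassmannian k}"
    using continuous_openin_preimage_gen[OF cont S] by simp
  then show "f -` S \<inter> space (grassmannian_borel idx k) \<in> sets (grassmannian_borel idx k)"
    unfolding space_grassmannian_borel sets_grassmannian_borel
    by (intro sigma_sets.Basic CollectI conjI Int_lower2)
qed

text \<open>
  Joint measurability follows from measurability in \<open>V\<close> alone because the squared norm is the quadratic form in \<open>x\<close>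
  whose coefficients are the Gram numbers \<open>P\<^sub>V e\<^sub>i \<bullet> P\<^sub>V e\<^sub>j\<close>; each of them lifts to a continuous function on the rotations.
\<close>

lemma measurable_norm_orth_proj:
  fixes idx :: "nat \<Rightarrow> 'n::finite"
  assumes inj: "inj_on idx {1..k}"
  shows "(\<lambda>(V, x). norm (orth_proj V x)) \<in> borel_measurable (grassmannian_borel idx k \<Otimes>\<^sub>M borel)"
proof -
  have nth: "(\<lambda>x :: real ^ 'n. x $ i) \<in> borel_measurable borel" for i
    by (intro borel_measurable_continuous_onI continuous_intros)
  have gram: "(\<lambda>V. orth_proj V a \<bullet> orth_proj V b) \<in> borel_measurable (grassmannian_borel idx k)"
    for a b :: "real ^ 'n"
  proof (rule measurable_grassmannian_borelI[OF inj])
    have tr: "continuous_on SO (\<lambda>T. transpose T *v c)" for c :: "real ^ 'n"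
      by (rule continuous_on_transpose_mult[OF continuous_on_id continuous_on_const])
    have "continuous_on SO (\<lambda>T. (transpose T *v a) \<bullet> coord_proj (idx ` {1..k}) (transpose T *v b))"
      by (rule continuous_on_inner[OF tr linear_continuous_on_compose[OF tr linear_coord_proj]])
    then show "continuous_on SO (\<lambda>T. orth_proj (rotated_subspace idx k T) a \<bullet> orth_proj (rotated_subspace idx k T) b)"
      by (rule continuous_on_cong[THEN iffD1, rotated 2]) (simp_all only: inner_orth_proj_rotated)
  qed
  have expand: "norm (orth_proj V x)
      = sqrt (\<Sum>i\<in>UNIV. \<Sum>j\<in>UNIV. x $ i * x $ j * (orth_proj V (axis j 1) \<bullet> orth_proj V (axis i 1)))"
    if "V \<in> grassmannian k" for V and x :: "real ^ 'n"
  proof -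
    interpret linear "orth_proj V" using that by (intro linear_orth_proj) (simp add: grassmannian_def)
    have "orth_proj V x = orth_proj V (\<Sum>i\<in>UNIV. x $ i *\<^sub>R axis i 1)"
      using basis_expansion[of x] by (simp add: scalar_mult_eq_scaleR)
    also have "\<dots> = (\<Sum>i\<in>UNIV. x $ i *\<^sub>R orth_proj V (axis i 1))"
      by (simp only: sum scale)
    finally have "norm (orth_proj V x) = norm (\<Sum>i\<in>UNIV. x $ i *\<^sub>R orth_proj V (axis i 1))"
      by (rule arg_cong)
    then show ?thesis
      by (simp add: norm_eq_sqrt_inner inner_sum_left inner_sum_right sum_distrib_left mult.assoc)
  qed
  note [measurable] = measurable_compose[OF measurable_fst gram] measurable_compose[OF measurable_snd nth]
  have "(\<lambda>(V, x :: real ^ 'n). sqrt (\<Sum>i\<in>UNIV. \<Sum>j\<in>UNIV. x $ i * x $ j * (orth_proj V (axis j 1) \<bullet> orth_proj V (axis i 1))))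
      \<in> borel_measurable (grassmannian_borel idx k \<Otimes>\<^sub>M borel)"
    unfolding case_prod_unfold
    by measurable
  then show ?thesis
    by (rule measurable_cong[THEN iffD1, rotated]) (auto simp: space_pair_measure space_grassmannian_borel expand)
qed

lemma measurable_rotated_subspace:
  fixes idx :: "nat \<Rightarrow> 'n::finite"
  assumes inj: "inj_on idx {1..k}" and \<mu>: "haar_prob_SO \<mu>"
  shows "rotated_subspace idx k \<in> measurable \<mu> (grassmannian_borel idx k)"
proof -
  have sets_\<mu>: "sets \<mu> = sets (restrict_space borel SO)" using \<mu> by (simp add: haar_prob_SO_def)
  then have sp: "space \<mu> = SO" by (auto dest: sets_eq_imp_space_eq simp: space_restrict_space)
  show ?thesis
    unfolding grassmannian_borel_def
  proof (rule measurable_measure_of)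
    fix W assume "W \<in> {W. W \<subseteq> grassmannian k \<and> openin (top_of_set SO) {T \<in> SO. rotated_subspace idx k T \<in> W}}"
    then obtain A where A: "open A" "{T \<in> SO. rotated_subspace idx k T \<in> W} = SO \<inter> A"
      by (auto simp: openin_open)
    have "rotated_subspace idx k -` W \<inter> space \<mu> = SO \<inter> A"
      using A(2) by (auto simp: sp)
    also have "\<dots> \<in> sets \<mu>"
      using A(1) by (auto simp: sets_\<mu> sets_restrict_space)
    finally show "rotated_subspace idx k -` W \<inter> space \<mu> \<in> sets \<mu>" .
  qed (use rotated_subspace_in_grassmannian[OF inj] in \<open>auto simp: sp\<close>)
qed

section \<open>Independence\<close>

lemma (in prob_space) indep_sets_reindex:
  assumes h: "inj_on h I" and indep: "indep_sets F (h ` I)"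
  shows "indep_sets (\<lambda>i. F (h i)) I"
proof (rule indep_setsI)
  fix i assume "i \<in> I"
  then show "F (h i) \<subseteq> events" using indep by (auto simp: indep_sets_def)
next
  fix A J assume J: "J \<noteq> {}" "J \<subseteq> I" "finite J" and A: "\<forall>j\<in>J. A j \<in> F (h j)"
  have inj: "inj_on h J" using h J(2) by (rule inj_on_subset)
  have inv: "inv_into J h (h j) = j" if "j \<in> J" for j using inj that by simp
  have "prob (\<Inter>i\<in>h ` J. A (inv_into J h i)) = (\<Prod>i\<in>h ` J. prob (A (inv_into J h i)))"
    using J A inv by (intro indep_setsD[OF indep]) auto
  then show "prob (\<Inter>j\<in>J. A j) = (\<Prod>j\<in>J. prob (A j))"
    by (simp add: prod.reindex[OF inj] inv cong: INF_cong prod.cong)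
qed

lemma (in prob_space) indep_vars_reindex:
  assumes "inj_on h I" "indep_vars M' X (h ` I)"
  shows "indep_vars (\<lambda>i. M' (h i)) (\<lambda>i. X (h i)) I"
  using assms(2) unfolding indep_vars_def2 by (auto intro: indep_sets_reindex[OF assms(1)])

lemma (in prob_space) distr_indep_rvs:
  assumes indep: "indep_rvs M S X T Y"
  shows "distr M (S \<Otimes>\<^sub>M T) (\<lambda>\<omega>. (X \<omega>, Y \<omega>)) = distr M S X \<Otimes>\<^sub>M distr M T Y"
proof (rule pair_measure_eqI[symmetric])
  have X[measurable]: "X \<in> measurable M S" and Y[measurable]: "Y \<in> measurable M T"
    and ind: "indep_set {X -` A \<inter> space M | A. A \<in> sets S} {Y -` B \<inter> space M | B. B \<in> sets T}"
    using indep by (auto simp: indep_rvs_def)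
  show "sigma_finite_measure (distr M S X)" "sigma_finite_measure (distr M T Y)"
    by (intro prob_space_imp_sigma_finite prob_space_distr X Y)+
  show "sets (distr M S X \<Otimes>\<^sub>M distr M T Y) = sets (distr M (S \<Otimes>\<^sub>M T) (\<lambda>\<omega>. (X \<omega>, Y \<omega>)))"
    by (simp cong: sets_pair_measure_cong)
  fix A B assume "A \<in> sets (distr M S X)" "B \<in> sets (distr M T Y)"
  then have A[measurable]: "A \<in> sets S" and B[measurable]: "B \<in> sets T" by auto
  have "prob ((X -` A \<inter> space M) \<inter> (Y -` B \<inter> space M)) = prob (X -` A \<inter> space M) * prob (Y -` B \<inter> space M)"
    using A B by (intro indep_setD[OF ind]) auto
  moreover have "(\<lambda>\<omega>. (X \<omega>, Y \<omega>)) -` (A \<times> B) \<inter> space M = (X -` A \<inter> space M) \<inter> (Y -` B \<inter> space M)"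
    by auto
  ultimately show "emeasure (distr M S X) A * emeasure (distr M T Y) B
      = emeasure (distr M (S \<Otimes>\<^sub>M T) (\<lambda>\<omega>. (X \<omega>, Y \<omega>))) (A \<times> B)"
    by (simp add: emeasure_distr emeasure_eq_measure ennreal_mult'')
qed

lemma (in prob_space) indep_var_distr_mult:
  fixes S R :: "'a \<Rightarrow> real"
  assumes "indep_var borel S borel R"
  shows "distr M borel (\<lambda>\<omega>. S \<omega> * R \<omega>) = distr (distr M borel S \<Otimes>\<^sub>M distr M borel R) borel (\<lambda>(s, r). s * r)"
proof -
  have [measurable]: "S \<in> borel_measurable M" "R \<in> borel_measurable M"
    using assms by (auto dest: indep_var_rv1 indep_var_rv2)
  have "distr M borel S \<Otimes>\<^sub>M distr M borel R = distr M (borel \<Otimes>\<^sub>M borel) (\<lambda>\<omega>. (S \<omega>, R \<omega>))"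
    using assms by (simp add: indep_var_distribution_eq)
  then show ?thesis by (simp add: distr_distr comp_def)
qed

section \<open>Length of the projection onto a random subspace\<close>

text \<open>
  Conditionally on \<open>X = x\<close> the projected length has the law of a Gaussian ratio that does not depend on \<open>x\<close>,
  scaled by the norm of \<open>x\<close>; integrating over \<open>x\<close> makes length and ratio independent factors.
\<close>

lemma distr_norm_orth_proj:
  fixes idx :: "nat \<Rightarrow> 'n::finite" and X :: "'a \<Rightarrow> real ^ 'n"
  assumes M: "prob_space M" and inj: "inj_on idx {1..k}" and \<mu>: "haar_prob_SO \<mu>"
    and E: "distr M (grassmannian_borel idx k) E = grassmannian_haar \<mu> idx k"
    and indep: "indep_rvs M borel X (grassmannian_borel idx k) E"
  shows "distr M borel (\<lambda>\<omega>. norm (orth_proj (E \<omega>) (X \<omega>)))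
       = distr (distr M borel (\<lambda>\<omega>. norm (X \<omega>)) \<Otimes>\<^sub>M
            distr gaussian_measure borel (\<lambda>y. norm (coord_proj (idx ` {1..k}) y) / norm y))
          borel (\<lambda>(s, r). s * r)"
    (is "_ = distr (?S \<Otimes>\<^sub>M ?R) borel _")
proof (rule measure_eqI)
  interpret M: prob_space M by (rule M)
  interpret \<mu>: prob_space \<mu> using \<mu> by (simp add: haar_prob_SO_def)
  interpret G: prob_space "gaussian_measure :: (real ^ 'n) measure" by (rule prob_space_gaussian_measure)
  let ?G = "grassmannian_borel idx k :: (real ^ 'n) set measure"
  let ?q = "\<lambda>y. norm (coord_proj (idx ` {1..k}) y)"
  have X[measurable]: "X \<in> borel_measurable M" and E_meas[measurable]: "E \<in> measurable M ?G"
    using indep by (auto simp: indep_rvs_def)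
  have rot[measurable]: "rotated_subspace idx k \<in> measurable \<mu> ?G"
    by (rule measurable_rotated_subspace[OF inj \<mu>])
  have q[measurable]: "?q \<in> borel_measurable borel"
    by measurable
  have space_\<mu>: "space \<mu> = SO"
    using \<mu> by (auto dest: sets_eq_imp_space_eq simp: space_restrict_space haar_prob_SO_def)
  interpret PX: prob_space "distr M borel X" by (rule M.prob_space_distr[OF X])
  interpret PE: prob_space "distr M ?G E" by (rule M.prob_space_distr[OF E_meas])
  interpret PS: prob_space ?S by (rule M.prob_space_distr) simp
  interpret PR: prob_space ?R by (rule G.prob_space_distr) measurable
  fix A assume "A \<in> sets (distr M borel (\<lambda>\<omega>. norm (orth_proj (E \<omega>) (X \<omega>))))"
  then have A[measurable]: "A \<in> sets borel" by simp
  have proj: "(\<lambda>(x, V). norm (orth_proj V x)) \<in> borel_measurable (borel \<Otimes>\<^sub>M ?G)"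
    using measurable_compose[OF measurable_pair_swap' measurable_norm_orth_proj[OF inj]]
    by (simp add: case_prod_unfold)
  have XE: "(\<lambda>\<omega>. (X \<omega>, E \<omega>)) \<in> measurable M (borel \<Otimes>\<^sub>M ?G)" by measurable
  have comp: "(\<lambda>\<omega>. norm (orth_proj (E \<omega>) (X \<omega>))) \<in> borel_measurable M"
    using measurable_compose[OF XE proj] by simp
  have ind_meas: "(\<lambda>(x, V). indicator A (norm (orth_proj V x)) :: ennreal) \<in> borel_measurable (borel \<Otimes>\<^sub>M ?G)"
    using measurable_compose[OF proj borel_measurable_indicator[OF A]] by (simp add: case_prod_unfold)
  have "emeasure (distr M borel (\<lambda>\<omega>. norm (orth_proj (E \<omega>) (X \<omega>)))) A
      = (\<integral>\<^sup>+\<omega>. indicator A (norm (orth_proj (E \<omega>) (X \<omega>))) \<partial>M)"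
    using nn_integral_distr[OF comp, of "indicator A"] by simp
  also have "\<dots> = (\<integral>\<^sup>+(x, V). indicator A (norm (orth_proj V x)) \<partial>distr M (borel \<Otimes>\<^sub>M ?G) (\<lambda>\<omega>. (X \<omega>, E \<omega>)))"
    using ind_meas by (subst nn_integral_distr[OF XE]) simp_all
  also have "\<dots> = (\<integral>\<^sup>+(x, V). indicator A (norm (orth_proj V x)) \<partial>(distr M borel X \<Otimes>\<^sub>M distr M ?G E))"
    by (simp only: M.distr_indep_rvs[OF indep])
  also have "\<dots> = (\<integral>\<^sup>+x. \<integral>\<^sup>+V. indicator A (norm (orth_proj V x)) \<partial>distr M ?G E \<partial>distr M borel X)"
    by (subst PE.nn_integral_fst[symmetric]) (use ind_meas in \<open>simp_all cong: measurable_cong_sets sets_pair_measure_cong\<close>)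
  also have "\<dots> = (\<integral>\<^sup>+x. \<integral>\<^sup>+r. indicator A (norm x * r) \<partial>?R \<partial>distr M borel X)"
  proof (rule nn_integral_cong)
    fix x :: "real ^ 'n"
    have V: "(\<lambda>V. norm (orth_proj V x)) \<in> borel_measurable ?G"
      using measurable_compose[OF measurable_Pair1'[of x borel ?G] proj] by simp
    have "(\<integral>\<^sup>+V. indicator A (norm (orth_proj V x)) \<partial>distr M ?G E)
        = (\<integral>\<^sup>+T. indicator A (norm (orth_proj (rotated_subspace idx k T) x)) \<partial>\<mu>)"
      unfolding E grassmannian_haar_def
      by (rule nn_integral_distr[OF rot measurable_compose[OF _ borel_measurable_indicator[OF A]]]) (simp add: V)
    also have "\<dots> = (\<integral>\<^sup>+T. indicator A (?q (transpose T *v x)) \<partial>\<mu>)"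
      by (intro nn_integral_cong) (simp only: space_\<mu> norm_orth_proj_rotated)
    also have "\<dots> = emeasure (distr \<mu> borel (\<lambda>T. ?q (transpose T *v x))) A"
    proof -
      have "(\<lambda>T. norm (orth_proj (rotated_subspace idx k T) x)) \<in> borel_measurable \<mu>"
        by (rule measurable_compose[OF rot V])
      then have "(\<lambda>T. ?q (transpose T *v x)) \<in> borel_measurable \<mu>"
        by (rule measurable_cong[THEN iffD1, rotated]) (simp only: space_\<mu> norm_orth_proj_rotated)
      from nn_integral_distr[OF this, of "indicator A"] show ?thesis by simp
    qed
    also have "\<dots> = emeasure (distr gaussian_measure borel (\<lambda>y. norm x * (?q y / norm y))) A"
      by (subst distr_haar_homogeneous[OF \<mu> q]) (simp_all add: linear_cmul[OF linear_coord_proj])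
    also have "distr gaussian_measure borel (\<lambda>y. norm x * (?q y / norm y)) = distr ?R borel (\<lambda>r. norm x * r)"
      by (subst distr_distr) (auto simp: comp_def)
    also have "emeasure (distr ?R borel (\<lambda>r. norm x * r)) A = (\<integral>\<^sup>+r. indicator A (norm x * r) \<partial>?R)"
    proof -
      have m: "(\<lambda>r. norm x * r) \<in> borel_measurable ?R" by measurable
      show ?thesis using nn_integral_distr[OF m, of "indicator A"] by simp
    qed
    finally show "(\<integral>\<^sup>+V. indicator A (norm (orth_proj V x)) \<partial>distr M ?G E) = (\<integral>\<^sup>+r. indicator A (norm x * r) \<partial>?R)" .
  qed
  also have "\<dots> = (\<integral>\<^sup>+s. \<integral>\<^sup>+r. indicator A (s * r) \<partial>?R \<partial>?S)"
  proof -
    have h: "(\<lambda>s. \<integral>\<^sup>+r. indicator A (s * r) \<partial>?R) \<in> borel_measurable borel"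
      by (rule PR.borel_measurable_nn_integral) measurable
    have norm: "norm \<in> measurable (distr M borel X) borel" by measurable
    have "?S = distr (distr M borel X) borel norm" by (simp add: distr_distr comp_def)
    then show ?thesis using nn_integral_distr[OF norm, of "\<lambda>s. \<integral>\<^sup>+r. indicator A (s * r) \<partial>?R"] h by simp
  qed
  also have "\<dots> = (\<integral>\<^sup>+(s, r). indicator A (s * r) \<partial>(?S \<Otimes>\<^sub>M ?R))"
    by (subst PR.nn_integral_fst[symmetric]) auto
  also have "\<dots> = emeasure (distr (?S \<Otimes>\<^sub>M ?R) borel (\<lambda>(s, r). s * r)) A"
  proof -
    have m: "(\<lambda>(s, r). s * r) \<in> borel_measurable (?S \<Otimes>\<^sub>M ?R)" by measurable
    show ?thesis using nn_integral_distr[OF m, of "indicator A"] by (simp add: case_prod_unfold)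
  qed
  finally show "emeasure (distr M borel (\<lambda>\<omega>. norm (orth_proj (E \<omega>) (X \<omega>)))) A
      = emeasure (distr (?S \<Otimes>\<^sub>M ?R) borel (\<lambda>(s, r). s * r)) A" .
qed simp

lemma sum_vec_enumeration:
  fixes idx :: "nat \<Rightarrow> 'n::finite"
  assumes idx: "bij_betw idx {1..CARD('n)} UNIV"
  shows "(\<Sum>j\<in>UNIV. F ((\<chi> j. Y (inv_into {1..CARD('n)} idx j)) $ j)) = (\<Sum>i=1..CARD('n). F (Y i))"
proof -
  have "(\<Sum>j\<in>UNIV. F (Y (inv_into {1..CARD('n)} idx j))) = (\<Sum>i=1..CARD('n). F (Y (inv_into {1..CARD('n)} idx (idx i))))"
    by (rule sum.reindex_bij_betw[OF idx, symmetric])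
  also have "\<dots> = (\<Sum>i=1..CARD('n). F (Y i))"
    by (intro sum.cong refl) (simp only: bij_betw_inv_into_left[OF idx])
  finally show ?thesis by simp
qed

lemma norm_coord_proj_enumeration:
  fixes idx :: "nat \<Rightarrow> 'n::finite"
  assumes idx: "bij_betw idx {1..CARD('n)} UNIV" and k: "k \<le> CARD('n)"
  shows "norm (coord_proj (idx ` {1..k}) (\<chi> j. Y (inv_into {1..CARD('n)} idx j))) = sqrt (\<Sum>i=1..k. (Y i)\<^sup>2)"
proof -
  let ?\<sigma> = "inv_into {1..CARD('n)} idx"
  have inj: "inj_on idx {1..k}"
    by (rule inj_on_subset[OF bij_betw_imp_inj_on[OF idx]]) (use k in auto)
  have "(\<Sum>j\<in>UNIV. (coord_proj (idx ` {1..k}) (\<chi> j. Y (?\<sigma> j)) $ j)\<^sup>2) = (\<Sum>j\<in>idx ` {1..k}. (Y (?\<sigma> j))\<^sup>2)"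
    by (rule sum.mono_neutral_cong_right) (auto simp: coord_proj_def)
  also have "\<dots> = (\<Sum>i=1..k. (Y i)\<^sup>2)"
    unfolding sum.reindex[OF inj] comp_def
  proof (rule sum.cong[OF refl])
    fix i assume "i \<in> {1..k}"
    then have "i \<in> {1..CARD('n)}" using k by auto
    then show "(Y (?\<sigma> (idx i)))\<^sup>2 = (Y i)\<^sup>2" by (simp only: bij_betw_inv_into_left[OF idx])
  qed
  finally show ?thesis by (simp only: norm_vec_def L2_set_def real_norm_def power2_abs)
qed

theorem theorem3p1:
  fixes M :: "'a measure" and N :: "'b measure"
    and p :: real and k :: nat and idx :: "nat \<Rightarrow> 'n::finite"
    and \<mu> :: "(real ^ 'n ^ 'n) measure"
    and X :: "'a \<Rightarrow> real ^ 'n" and E :: "'a \<Rightarrow> (real ^ 'n) set"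
    and U :: "'b \<Rightarrow> real" and Z g :: "nat \<Rightarrow> 'b \<Rightarrow> real"
  assumes k: "k \<in> {1..CARD('n)}" and p: "p \<ge> 1"
    and idx: "bij_betw idx {1..CARD('n)} UNIV"
    and \<mu>: "haar_prob_SO \<mu>"
    and M: "prob_space M"
    and X: "X \<in> borel_measurable M" "distr M borel X = uniform_measure lborel (lp_ball p)"
    and E: "E \<in> measurable M (grassmannian_borel idx k)"
           "distr M (grassmannian_borel idx k) E = grassmannian_haar \<mu> idx k"
    and indep_XE: "indep_rvs M borel X (grassmannian_borel idx k) E"
    and N: "prob_space N"
    and U: "U \<in> borel_measurable N" "distr N borel U = uniform_measure lborel {0..1}"
    and Z: "\<And>i. i \<in> {1..CARD('n)} \<Longrightarrow> distributed N lborel (Z i) (p_gaussian_density p)"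
    and g: "\<And>i. i \<in> {1..CARD('n)} \<Longrightarrow> distributed N lborel (g i) std_normal_density"
    and indep: "prob_space.indep_vars N (\<lambda>_. borel) (case_sum (\<lambda>_::unit. U) (case_sum Z g))
                  ({()} <+> ({1..CARD('n)} <+> {1..CARD('n)}))"
  shows "distr M borel (\<lambda>\<omega>. norm (orth_proj (E \<omega>) (X \<omega>))) =
         distr N borel (\<lambda>\<omega>.
           U \<omega> powr (1 / real CARD('n))
           * (sqrt (\<Sum>i=1..CARD('n). (Z i \<omega>)\<^sup>2)
              / (\<Sum>i=1..CARD('n). \<bar>Z i \<omega>\<bar> powr p) powr (1 / p))
           * (sqrt (\<Sum>i=1..k. (g i \<omega>)\<^sup>2) / sqrt (\<Sum>i=1..CARD('n). (g i \<omega>)\<^sup>2)))"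
proof -
  interpret N: prob_space N by (rule N)
  define n where "n = CARD('n)"
  define \<sigma> where "\<sigma> = inv_into {1..CARD('n)} idx"
  have \<sigma>: "\<sigma> j \<in> {1..CARD('n)}" for j
    using bij_betwE[OF bij_betw_inv_into[OF idx]] by (simp add: \<sigma>_def)
  have inj_\<sigma>: "inj \<sigma>"
    using bij_betw_inv_into[OF idx] by (simp add: \<sigma>_def bij_betw_def)
  have inj: "inj_on idx {1..k}"
    by (rule inj_on_subset[OF bij_betw_imp_inj_on[OF idx]]) (use k in auto)
  let ?J = "idx ` {1..k}"
  define Zv where "Zv \<omega> = (\<chi> j. Z (\<sigma> j) \<omega>)" for \<omega>
  define gv where "gv \<omega> = (\<chi> j. g (\<sigma> j) \<omega>)" for \<omega>
  define \<rho> where "\<rho> z = norm z / lp_norm p z" for z :: "real ^ 'n"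
  define \<theta> where "\<theta> y = norm (coord_proj ?J y) / norm y" for y :: "real ^ 'n"
  define S where "S \<omega> = U \<omega> powr (1 / n) * \<rho> (Zv \<omega>)" for \<omega>
  define R where "R \<omega> = \<theta> (gv \<omega>)" for \<omega>
  define W where "W = case_sum (\<lambda>_::unit. U) (case_sum Z g)"
  define I where "I = {()} <+> ({1..CARD('n)} <+> {1..CARD('n)})"
  have W: "N.indep_vars (\<lambda>_. borel) W I" using indep by (simp add: W_def I_def)
  have I_mem: "Inr (Inl (\<sigma> j)) \<in> I" "Inr (Inr (\<sigma> j)) \<in> I" for j
    unfolding I_def by (intro InlI InrI \<sigma>)+
  have \<rho>_meas[measurable]: "\<rho> \<in> borel_measurable borel" unfolding \<rho>_def by measurable
  have \<theta>_meas[measurable]: "\<theta> \<in> borel_measurable borel" unfolding \<theta>_def by measurable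

  have Z_law: "distr N borel Zv = density lborel (\<lambda>x. ennreal (p_gaussian_profile p n (lp_norm p x)))"
  proof -
    have "N.indep_vars (\<lambda>_. borel) (\<lambda>j. W (Inr (Inl (\<sigma> j)))) UNIV"
    proof (rule N.indep_vars_reindex)
      show "inj (\<lambda>j. Inr (Inl (\<sigma> j)))" using inj_\<sigma> by (simp add: inj_def)
      show "N.indep_vars (\<lambda>_. borel) W (range (\<lambda>j. Inr (Inl (\<sigma> j))))"
        by (intro N.indep_vars_subset[OF W] image_subsetI I_mem)
    qed
    then have ind: "N.indep_vars (\<lambda>_. borel) (\<lambda>j. Z (\<sigma> j)) UNIV" by (simp add: W_def)
    have "p_gaussian_density p \<in> borel_measurable borel" unfolding p_gaussian_density_def by measurable
    from N.distr_indep_coordinates[OF this p_gaussian_density_nonneg[OF p] Z[OF \<sigma>] ind]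
    show ?thesis by (simp add: Zv_def[abs_def] prod_p_gaussian_density[OF p] n_def)
  qed
  have g_law: "distr N borel gv = gaussian_measure"
  proof -
    have "N.indep_vars (\<lambda>_. borel) (\<lambda>j. W (Inr (Inr (\<sigma> j)))) UNIV"
    proof (rule N.indep_vars_reindex)
      show "inj (\<lambda>j. Inr (Inr (\<sigma> j)))" using inj_\<sigma> by (simp add: inj_def)
      show "N.indep_vars (\<lambda>_. borel) W (range (\<lambda>j. Inr (Inr (\<sigma> j))))"
        by (intro N.indep_vars_subset[OF W] image_subsetI I_mem)
    qed
    then have ind: "N.indep_vars (\<lambda>_. borel) (\<lambda>j. g (\<sigma> j)) UNIV" by (simp add: W_def)
    show ?thesis
      unfolding gaussian_measure_def gv_def[abs_def]
      by (rule N.distr_indep_coordinates[OF _ _ g[OF \<sigma>] ind]) auto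
  qed
  have rv: "W i \<in> borel_measurable N" if "i \<in> I" for i
    using W that by (simp add: N.indep_vars_def)
  have Zv_meas[measurable]: "Zv \<in> borel_measurable N"
    unfolding Zv_def[abs_def] using rv[OF I_mem(1)] by (intro borel_measurable_vec_lambda) (simp add: W_def)
  have gv_meas[measurable]: "gv \<in> borel_measurable N"
    unfolding gv_def[abs_def] using rv[OF I_mem(2)] by (intro borel_measurable_vec_lambda) (simp add: W_def)
  note [measurable] = U(1)

  \<comment> \<open>Disjoint blocks of the independent family are independent, first U against Z (for the representation of X),
    then U and Z together against g (for the final product).\<close>
  have U_Z: "N.indep_var borel U borel (\<lambda>\<omega>. \<rho> (Zv \<omega>))"
  proof -
    let ?A = "{Inl ()} :: (unit + nat + nat) set" and ?B = "Inr ` Inl ` {1..CARD('n)} :: (unit + nat + nat) set"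
    have [measurable]: "(\<lambda>w. w (Inl ())) \<in> borel_measurable (\<Pi>\<^sub>M i\<in>?A. borel :: real measure)"
      by (rule measurable_component_singleton) simp
    have [measurable]: "(\<lambda>w. \<chi> j. w (Inr (Inl (\<sigma> j)))) \<in> borel_measurable (\<Pi>\<^sub>M i\<in>?B. borel :: real measure)"
      using \<sigma> by (intro borel_measurable_vec_lambda measurable_component_singleton) simp
    have restr: "N.indep_var (\<Pi>\<^sub>M i\<in>?A. borel) (\<lambda>\<omega>. \<lambda>i\<in>?A. W i \<omega>) (\<Pi>\<^sub>M i\<in>?B. borel) (\<lambda>\<omega>. \<lambda>i\<in>?B. W i \<omega>)"
      by (rule N.indep_var_restrict[OF W]) (auto simp: I_def)
    have "N.indep_var borel ((\<lambda>w. w (Inl ())) \<circ> (\<lambda>\<omega>. \<lambda>i\<in>?A. W i \<omega>))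
        borel ((\<lambda>w. \<rho> (\<chi> j. w (Inr (Inl (\<sigma> j))))) \<circ> (\<lambda>\<omega>. \<lambda>i\<in>?B. W i \<omega>))"
      by (rule N.indep_var_compose[OF restr]) measurable
    then show ?thesis using \<sigma> by (simp add: comp_def W_def Zv_def)
  qed
  have S_R: "N.indep_var borel S borel R"
  proof -
    let ?A = "insert (Inl ()) (Inr ` Inl ` {1..CARD('n)}) :: (unit + nat + nat) set"
      and ?B = "Inr ` Inr ` {1..CARD('n)} :: (unit + nat + nat) set"
    have [measurable]: "(\<lambda>w. w (Inl ())) \<in> borel_measurable (\<Pi>\<^sub>M i\<in>?A. borel :: real measure)"
      by (rule measurable_component_singleton) simp
    have [measurable]: "(\<lambda>w. \<chi> j. w (Inr (Inl (\<sigma> j)))) \<in> borel_measurable (\<Pi>\<^sub>M i\<in>?A. borel :: real measure)"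
      using \<sigma> by (intro borel_measurable_vec_lambda measurable_component_singleton) simp
    have [measurable]: "(\<lambda>w. \<chi> j. w (Inr (Inr (\<sigma> j)))) \<in> borel_measurable (\<Pi>\<^sub>M i\<in>?B. borel :: real measure)"
      using \<sigma> by (intro borel_measurable_vec_lambda measurable_component_singleton) simp
    have restr: "N.indep_var (\<Pi>\<^sub>M i\<in>?A. borel) (\<lambda>\<omega>. \<lambda>i\<in>?A. W i \<omega>) (\<Pi>\<^sub>M i\<in>?B. borel) (\<lambda>\<omega>. \<lambda>i\<in>?B. W i \<omega>)"
      by (rule N.indep_var_restrict[OF W]) (auto simp: I_def)
    have "N.indep_var borel ((\<lambda>w. w (Inl ()) powr (1 / n) * \<rho> (\<chi> j. w (Inr (Inl (\<sigma> j))))) \<circ> (\<lambda>\<omega>. \<lambda>i\<in>?A. W i \<omega>))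
        borel ((\<lambda>w. \<theta> (\<chi> j. w (Inr (Inr (\<sigma> j))))) \<circ> (\<lambda>\<omega>. \<lambda>i\<in>?B. W i \<omega>))"
      by (rule N.indep_var_compose[OF restr]) measurable
    then show ?thesis using \<sigma> by (simp add: comp_def W_def Zv_def gv_def S_def[abs_def] R_def[abs_def])
  qed

  have S_law: "distr M borel (\<lambda>\<omega>. norm (X \<omega>)) = distr N borel S"
  proof -
    let ?D = "density lborel (\<lambda>x :: real ^ 'n. ennreal (p_gaussian_profile p n (lp_norm p x)))"
    let ?U = "uniform_measure lborel {0..1::real}"
    have prob_D: "prob_space ?D" using N.prob_space_distr[OF Zv_meas] by (simp add: Z_law)
    interpret D: prob_space ?D by (rule prob_D)
    interpret \<rho>D: prob_space "distr ?D borel \<rho>" by (rule D.prob_space_distr) simp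
    have profile: "p_gaussian_profile p n \<in> borel_measurable borel" unfolding p_gaussian_profile_def by measurable
    have "distr M borel (\<lambda>\<omega>. norm (X \<omega>)) = distr (distr M borel X) borel norm"
      using X(1) by (simp add: distr_distr comp_def)
    also have "\<dots> = distr (uniform_measure lborel {x :: real ^ 'n. lp_norm p x \<le> 1}) borel norm"
      by (simp add: X(2) lp_ball_def)
    also have "\<dots> = distr (?U \<Otimes>\<^sub>M ?D) borel (\<lambda>(u, z). u powr (1 / n) * \<rho> z)"
      using distr_gauge_uniform_ball[OF _ _ profile gauge_function_lp_norm gauge_function_norm p_gaussian_profile_nonneg[OF p] prob_D] p
      by (simp add: \<rho>_def n_def)
    also have "\<dots> = distr (distr (?U \<Otimes>\<^sub>M ?D) (borel \<Otimes>\<^sub>M borel) (\<lambda>(u, z). (u, \<rho> z))) borel (\<lambda>(u, r). u powr (1 / n) * r)"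
      by (subst distr_distr) (auto simp: comp_def case_prod_unfold)
    also have "distr (?U \<Otimes>\<^sub>M ?D) (borel \<Otimes>\<^sub>M borel) (\<lambda>(u, z). (u, \<rho> z)) = distr ?U borel (\<lambda>u. u) \<Otimes>\<^sub>M distr ?D borel \<rho>"
      by (rule pair_measure_distr[symmetric]) (auto intro: \<rho>D.sigma_finite_measure_axioms)
    also have "\<dots> = distr N borel U \<Otimes>\<^sub>M distr N borel (\<lambda>\<omega>. \<rho> (Zv \<omega>))"
      by (simp add: U(2) distr_distr distr_id2 comp_def flip: Z_law)
    also have "\<dots> = distr N (borel \<Otimes>\<^sub>M borel) (\<lambda>\<omega>. (U \<omega>, \<rho> (Zv \<omega>)))"
      using U_Z by (simp add: N.indep_var_distribution_eq)
    also have "distr \<dots> borel (\<lambda>(u, r). u powr (1 / n) * r) = distr N borel S"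
      by (subst distr_distr) (auto simp: comp_def S_def[abs_def])
    finally show ?thesis .
  qed
  have R_law: "distr gaussian_measure borel \<theta> = distr N borel R"
    by (simp add: distr_distr comp_def R_def[abs_def] flip: g_law)

  have "distr M borel (\<lambda>\<omega>. norm (orth_proj (E \<omega>) (X \<omega>)))
      = distr (distr M borel (\<lambda>\<omega>. norm (X \<omega>)) \<Otimes>\<^sub>M distr gaussian_measure borel \<theta>) borel (\<lambda>(s, r). s * r)"
    using distr_norm_orth_proj[OF M inj \<mu> E(2) indep_XE] by (simp add: \<theta>_def[abs_def])
  also have "\<dots> = distr N borel (\<lambda>\<omega>. S \<omega> * R \<omega>)"
    by (simp only: S_law R_law N.indep_var_distr_mult[OF S_R])
  also have "(\<lambda>\<omega>. S \<omega> * R \<omega>) = (\<lambda>\<omega>.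
           U \<omega> powr (1 / real CARD('n))
           * (sqrt (\<Sum>i=1..CARD('n). (Z i \<omega>)\<^sup>2)
              / (\<Sum>i=1..CARD('n). \<bar>Z i \<omega>\<bar> powr p) powr (1 / p))
           * (sqrt (\<Sum>i=1..k. (g i \<omega>)\<^sup>2) / sqrt (\<Sum>i=1..CARD('n). (g i \<omega>)\<^sup>2)))"
  proof
    fix \<omega>
    have nrm: "norm (\<chi> j. Y (\<sigma> j) \<omega>) = sqrt (\<Sum>i=1..CARD('n). (Y i \<omega>)\<^sup>2)" for Y :: "nat \<Rightarrow> 'b \<Rightarrow> real"
      using sum_vec_enumeration[OF idx, of "\<lambda>t. t\<^sup>2" "\<lambda>i. Y i \<omega>"]
      by (simp add: norm_vec_def L2_set_def \<sigma>_def)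
    have lp: "lp_norm p (\<chi> j. Z (\<sigma> j) \<omega>) = (\<Sum>i=1..CARD('n). \<bar>Z i \<omega>\<bar> powr p) powr (1 / p)"
      using sum_vec_enumeration[OF idx, of "\<lambda>t. \<bar>t\<bar> powr p" "\<lambda>i. Z i \<omega>"]
      by (simp add: lp_norm_def \<sigma>_def)
    have "norm (coord_proj ?J (\<chi> j. g (\<sigma> j) \<omega>)) = sqrt (\<Sum>i=1..k. (g i \<omega>)\<^sup>2)"
      unfolding \<sigma>_def using k by (intro norm_coord_proj_enumeration[OF idx]) simp
    then show "S \<omega> * R \<omega> = U \<omega> powr (1 / real CARD('n))
           * (sqrt (\<Sum>i=1..CARD('n). (Z i \<omega>)\<^sup>2)
              / (\<Sum>i=1..CARD('n). \<bar>Z i \<omega>\<bar> powr p) powr (1 / p))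
           * (sqrt (\<Sum>i=1..k. (g i \<omega>)\<^sup>2) / sqrt (\<Sum>i=1..CARD('n). (g i \<omega>)\<^sup>2))"
      by (simp add: S_def R_def \<rho>_def \<theta>_def Zv_def gv_def n_def nrm lp)
  qed
  finally show ?thesis .
qed

end
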